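(* Consider the online problem and the algorithm O-DGT with true gradients described in the context. Assume: (1) each $X_i\subseteq\mathbb{R}^{n_i}$ is nonempty, convex and compact, and there is $B>0$ with $\|x_i\|\le B$ for all $x_i\in X_i$, $i\in[N]$; (2) $f_t:\mathbb{R}^n\to\mathbb{R}$ is convex for all $t\ge 0$; (3) there is $L_1$ such that $\|\nabla_1 f_t(x,y)-\nabla_1 f_t(x',y')\|\le L_1(\|x-x'\|+\|y-y'\|)$ and $\|\nabla_2 f_t(x,y)-\nabla_2 f_t(x',y')\|\le L_1(\|x-x'\|+\|y-y'\|)$ for all $x,x'\in X$, $y,y'\in\mathbb{R}^{Nd}$, $t\ge 0$; (4) there is $G>0$ such that $\|\nabla_1 f_t(x,y)\|\le G$, $\|\nabla_2 f_t(x,y)\|\le G$, $\|\nabla\psi_i(x_i)\|\le G$ for all $x\in X$, $y\in\mathbb{R}^{Nd}$, $t\ge 0$, $i\in[N]$; (5) there is $L_2$ such that $\|\nabla\psi_i(x)-\nabla\psi_i(x')\|\le L_2\|x-x'\|$ for all $x,x'\in X_i$, $i\in[N]$; (6) there is an integer $Q>0$ such that the union graph $(\mathcal{V},\bigcup_{l=0}^{Q-1}\mathcal{E}_{k+l})$ is strongly connected for every $k\ge 0$; (7) $A_t=(a_{ij,t})$ is doubly stochastic for every $t\ge 0$; (8) there is $a\in(0,1)$ such that, for all $t\ge0$, $a_{ij,t}\ge a$ whenever $a_{ij,t}>0$, and $a_{ii,t}\ge a$ for all $i\in[N]$. Let $\alpha_0=1$ and $\alpha_t=1/\sqrt{t}$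 for $t\ge 1$. Then $$\mathcal{R}_T=O(\sqrt{T})+O\big(V^p_{T,\alpha_t^{-1}}\big)+O\big(\max\{V_T^g,V_{T,\alpha_t}^g\}\big),$$ where $$V_{T,\alpha_t^{-1}}^p=\sum_{t=1}^T\frac{1}{\alpha_t}\|x_{t+1}^*-x_t^*\|,\qquad V_T^g=\sum_{t=1}^T\sum_{i=1}^N\sup_{x_i\in X_i,\,z_i\in\mathbb{R}^d}\|\nabla_2f_{i,t+1}(x_i,z_i)-\nabla_2f_{i,t}(x_i,z_i)\|,$$ $$V_{T,\alpha_t}^g=\sum_{t=1}^T\alpha_t\Big(\sum_{i=1}^N\sup_{x_i\in X_i,\,z_i\in\mathbb{R}^d}\|\nabla_2f_{i,t+1}(x_i,z_i)-\nabla_2f_{i,t}(x_i,z_i)\|\Big)^2.$$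
   Context: Notation: $[N]=\{1,\dots,N\}$; $col(z_1,\dots,z_k)$ stacks column vectors; $\|\cdot\|$ is the Euclidean norm (for matrices, the induced norm); $P_S$ is Euclidean projection onto a closed convex set $S$. Problem. There are $N$ agents; $n=\sum_{i=1}^N n_i$; $X_i\subseteq\mathbb{R}^{n_i}$, $X=\prod_{i=1}^N X_i$; $\psi_i:\mathbb{R}^{n_i}\to\mathbb{R}^d$ is differentiable. For $x=col(x_1,\dots,x_N)$ the aggregative variable is $\nu(x)=\frac1N\sum_{i=1}^N\psi_i(x_i)$. For each $t=0,1,2,\dots$ and $i\in[N]$ there is a differentiable local loss $f_{i,t}:\mathbb{R}^{n_i}\times\mathbb{R}^d\to\mathbb{R}$, and $f_t(x)=\sum_{i=1}^N f_{i,t}(x_i,\nu(x))$. $\nabla_1 f_{i,t}$ and $\nabla_2 f_{i,t}$ are the gradients in the first and second argument. For a vector-valued $g=col(g_1,\dots,g_m)$, $\nabla g=(\nabla g_1,\dots,\nabla g_m)$ (transposed Jacobian), so $\nabla\psi_i(x_i)\in\mathbb{R}^{n_i\times d}$. For $x\in\mathbb{R}^n$, $y=col(y_1,\dots,y_N)\in\mathbb{R}^{Nd}$ and $k=1,2$: $\nabla_k f_t(x,y)=col(\nabla_k f_{1,t}(x_1,y_1),\dots,\nabla_k f_{N,t}(x_N,y_N))$. Network. For each $t\ge0$, $\mathcal{G}_t=(\mathcal{V},\mathcal{E}_t)$ is a directed graph on $\mathcal{V}=[N]$ with matrix $A_t=(a_{ij,t})\in\mathbb{R}^{N\times N}$ with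 nonnegative entries; for $i\ne j$, $a_{ij,t}>0$ if $(j,i)\in\mathcal{E}_t$ and $a_{ij,t}=0$ otherwise. Algorithm (O-DGT with true gradients), stepsizes $\alpha_t>0$. Initialize $x_{i,0}\in X_i$ arbitrarily, $\nu_{i,0}=\psi_i(x_{i,0})$, $y_{i,0}=\nabla_2 f_{i,0}(x_{i,0},\nu_{i,0})$. For $t\ge 0$ and each $i\in[N]$: $x_{i,t+1}=P_{X_i}[x_{i,t}-\alpha_t(\nabla_1 f_{i,t}(x_{i,t},\nu_{i,t})+\nabla\psi_i(x_{i,t})y_{i,t})]$, $\nu_{i,t+1}=\sum_{j=1}^N a_{ij,t}\nu_{j,t}+\psi_i(x_{i,t+1})-\psi_i(x_{i,t})$, $y_{i,t+1}=\sum_{j=1}^N a_{ij,t}y_{j,t}+\nabla_2 f_{i,t+1}(x_{i,t+1},\nu_{i,t+1})-\nabla_2 f_{i,t}(x_{i,t},\nu_{i,t})$. Write $x_t=col(x_{1,t},\dots,x_{N,t})$. Dynamic regret: $\mathcal{R}_T=\sum_{t=1}^T f_t(x_t)-\sum_{t=1}^T f_t(x_t^* )$, where $x_t^*\in\arg\min_{x\in X}f_t(x)$ is a (fixed) minimizer. $O(\cdot)$ is with respect to the horizon $T\ge1$: implied constants do not depend on $T$ (they may depend on the other fixed parameters of the problem). *)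

theory Defs
  imports
    "HOL-Analysis.Analysis"
    "HOL-Library.Landau_Symbols"
    "Graph_Theory.Digraph_Component"
begin

text \<open>
  The agents form a finite type \<open>'n\<close>. Since the dimensions of the local decision spaces may differ
  from agent to agent, the space of agent \<open>i\<close> is the coordinate subspace of \<open>real ^ 'm\<close> spanned
  by a set \<open>K i\<close> of coordinates, so its dimension is \<open>card (K i)\<close>. Stacked vectors have
  type \<open>real ^ 'm ^ 'n\<close> and \<open>real ^ 'd ^ 'n\<close>; the library norm of these types is the Euclidean
  norm of the stacked vector. Functions on the space of agent \<open>i\<close> are total functions
  on \<open>real ^ 'm\<close> whose values outside the coordinate subspace play no role.
\<close>

definition coord_space :: "'m set \<Rightarrow> (real ^ 'm) set" where
  "coord_space K = {v. \<forall>k. k \<notin> K \<longrightarrow> v $ k = 0}"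

definition stacked :: "('n \<Rightarrow> 'a set) \<Rightarrow> ('a ^ 'n) set" where
  "stacked S = {x. \<forall>i. x $ i \<in> S i}"

text \<open>
  Gradient at \<open>x\<close> of a function on the Euclidean space \<open>S\<close>, where \<open>S\<close> is a linear subspace of the
  ambient type. The requirement \<open>g \<in> S\<close> makes the gradient unique, see \<open>grad_on_eqI\<close> below.
\<close>

definition grad_on :: "'a set \<Rightarrow> ('a :: euclidean_space \<Rightarrow> real) \<Rightarrow> 'a \<Rightarrow> 'a" where
  "grad_on S f x = (THE g. g \<in> S \<and> (f has_derivative (\<lambda>h. g \<bullet> h)) (at x within S))"

text \<open>
  The transposed Jacobian: its columns are the gradients of the components. Rows outside \<open>K\<close> vanish,
  so that the induced norm is that of the \<open>card K\<close> by \<open>'d\<close> matrix.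
\<close>

definition jacobian_T :: "'m set \<Rightarrow> (real ^ 'm \<Rightarrow> real ^ 'd) \<Rightarrow> real ^ 'm \<Rightarrow> real ^ 'd ^ 'm" where
  "jacobian_T K \<psi> v = transpose (\<chi> l. grad_on (coord_space K) (\<lambda>u. \<psi> u $ l) v)"

definition mat_norm :: "real ^ 'd ^ 'm \<Rightarrow> real" where
  "mat_norm M = onorm (\<lambda>z. M *v z)"

definition aggregate :: "('n \<Rightarrow> real ^ 'm \<Rightarrow> real ^ 'd) \<Rightarrow> real ^ 'm ^ 'n \<Rightarrow> real ^ 'd" where
  "aggregate \<psi> x = (1 / real CARD('n)) *\<^sub>R (\<Sum>i\<in>UNIV. \<psi> i (x $ i))"

definition total_loss ::
  "(nat \<Rightarrow> 'n \<Rightarrow> real ^ 'm \<Rightarrow> real ^ 'd \<Rightarrow> real) \<Rightarrow> ('n \<Rightarrow> real ^ 'm \<Rightarrow> real ^ 'd) \<Rightarrow>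
   nat \<Rightarrow> real ^ 'm ^ 'n \<Rightarrow> real" where
  "total_loss f \<psi> t x = (\<Sum>i\<in>UNIV. f t i (x $ i) (aggregate \<psi> x))"

definition grad1 ::
  "('n \<Rightarrow> 'm set) \<Rightarrow> (nat \<Rightarrow> 'n \<Rightarrow> real ^ 'm \<Rightarrow> real ^ 'd \<Rightarrow> real) \<Rightarrow>
   nat \<Rightarrow> real ^ 'm ^ 'n \<Rightarrow> real ^ 'd ^ 'n \<Rightarrow> real ^ 'm ^ 'n" where
  "grad1 K f t x y = (\<chi> i. grad_on (coord_space (K i)) (\<lambda>v. f t i v (y $ i)) (x $ i))"

definition grad2 ::
  "(nat \<Rightarrow> 'n \<Rightarrow> real ^ 'm \<Rightarrow> real ^ 'd \<Rightarrow> real) \<Rightarrow>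
   nat \<Rightarrow> real ^ 'm ^ 'n \<Rightarrow> real ^ 'd ^ 'n \<Rightarrow> real ^ 'd ^ 'n" where
  "grad2 f t x y = (\<chi> i. grad_on UNIV (\<lambda>z. f t i (x $ i) z) (y $ i))"

definition digraph_of :: "('n \<times> 'n) set \<Rightarrow> ('n, 'n \<times> 'n) pre_digraph" where
  "digraph_of E = \<lparr>verts = UNIV, arcs = E, tail = fst, head = snd\<rparr>"

definition doubly_stochastic :: "real ^ 'n ^ 'n \<Rightarrow> bool" where
  "doubly_stochastic A \<longleftrightarrow>
     (\<forall>i j. 0 \<le> A $ i $ j) \<and> (\<forall>i. (\<Sum>j\<in>UNIV. A $ i $ j) = 1) \<and> (\<forall>j. (\<Sum>i\<in>UNIV. A $ i $ j) = 1)"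

text \<open>
  The sequences \<open>x\<close>, \<open>\<nu>\<close>, \<open>y\<close> are a run of the projected distributed gradient tracking algorithm.
\<close>

definition odgt_run ::
  "('n \<Rightarrow> 'm set) \<Rightarrow> ('n \<Rightarrow> (real ^ 'm) set) \<Rightarrow> ('n \<Rightarrow> real ^ 'm \<Rightarrow> real ^ 'd) \<Rightarrow>
   (nat \<Rightarrow> 'n \<Rightarrow> real ^ 'm \<Rightarrow> real ^ 'd \<Rightarrow> real) \<Rightarrow> (nat \<Rightarrow> real ^ 'n ^ 'n) \<Rightarrow> (nat \<Rightarrow> real) \<Rightarrow>
   (nat \<Rightarrow> real ^ 'm ^ 'n) \<Rightarrow> (nat \<Rightarrow> real ^ 'd ^ 'n) \<Rightarrow> (nat \<Rightarrow> real ^ 'd ^ 'n) \<Rightarrow> bool" where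
  "odgt_run K X \<psi> f A \<alpha> x \<nu> y \<longleftrightarrow>
     (\<forall>i. x 0 $ i \<in> X i) \<and>
     (\<forall>i. \<nu> 0 $ i = \<psi> i (x 0 $ i)) \<and>
     (\<forall>i. y 0 $ i = grad2 f 0 (x 0) (\<nu> 0) $ i) \<and>
     (\<forall>t i. x (Suc t) $ i =
        closest_point (X i)
          (x t $ i - \<alpha> t *\<^sub>R (grad1 K f t (x t) (\<nu> t) $ i
                              + jacobian_T (K i) (\<psi> i) (x t $ i) *v (y t $ i)))) \<and>
     (\<forall>t i. \<nu> (Suc t) $ i =
        (\<Sum>j\<in>UNIV. A t $ i $ j *\<^sub>R (\<nu> t $ j)) + \<psi> i (x (Suc t) $ i) - \<psi> i (x t $ i)) \<and>
     (\<forall>t i. y (Suc t) $ i =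
        (\<Sum>j\<in>UNIV. A t $ i $ j *\<^sub>R (y t $ j))
          + grad2 f (Suc t) (x (Suc t)) (\<nu> (Suc t)) $ i - grad2 f t (x t) (\<nu> t) $ i)"

definition dynamic_regret ::
  "(nat \<Rightarrow> 'n \<Rightarrow> real ^ 'm \<Rightarrow> real ^ 'd \<Rightarrow> real) \<Rightarrow> ('n \<Rightarrow> real ^ 'm \<Rightarrow> real ^ 'd) \<Rightarrow>
   (nat \<Rightarrow> real ^ 'm ^ 'n) \<Rightarrow> (nat \<Rightarrow> real ^ 'm ^ 'n) \<Rightarrow> nat \<Rightarrow> real" where
  "dynamic_regret f \<psi> x xopt T =
     (\<Sum>t=1..T. total_loss f \<psi> t (x t)) - (\<Sum>t=1..T. total_loss f \<psi> t (xopt t))"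

definition path_variation :: "(nat \<Rightarrow> real) \<Rightarrow> (nat \<Rightarrow> real ^ 'm ^ 'n) \<Rightarrow> nat \<Rightarrow> real" where
  "path_variation \<alpha> xopt T = (\<Sum>t=1..T. 1 / \<alpha> t * norm (xopt (Suc t) - xopt t))"

definition grad_change ::
  "('n \<Rightarrow> (real ^ 'm) set) \<Rightarrow> (nat \<Rightarrow> 'n \<Rightarrow> real ^ 'm \<Rightarrow> real ^ 'd \<Rightarrow> real) \<Rightarrow> nat \<Rightarrow> real" where
  "grad_change X f t =
     (\<Sum>i\<in>UNIV. SUP (v, z)\<in>X i \<times> UNIV. norm (grad_on UNIV (f (Suc t) i v) z - grad_on UNIV (f t i v) z))"

definition grad_variation ::
  "('n \<Rightarrow> (real ^ 'm) set) \<Rightarrow> (nat \<Rightarrow> 'n \<Rightarrow> real ^ 'm \<Rightarrow> real ^ 'd \<Rightarrow> real) \<Rightarrow> nat \<Rightarrow> real" where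
  "grad_variation X f T = (\<Sum>t=1..T. grad_change X f t)"

definition grad_variation_weighted ::
  "(nat \<Rightarrow> real) \<Rightarrow> ('n \<Rightarrow> (real ^ 'm) set) \<Rightarrow>
   (nat \<Rightarrow> 'n \<Rightarrow> real ^ 'm \<Rightarrow> real ^ 'd \<Rightarrow> real) \<Rightarrow> nat \<Rightarrow> real" where
  "grad_variation_weighted \<alpha> X f T = (\<Sum>t=1..T. \<alpha> t * (grad_change X f t)\<^sup>2)"

text \<open>\<open>O(g)\<close> for functions of a horizon \<open>T \<ge> 1\<close>: the bound is required for every \<open>T \<ge> 1\<close>.\<close>

abbreviation horizon :: "nat filter" where
  "horizon \<equiv> principal {1..}"

lemma subspace_coord_space: "subspace (coord_space K)"
  by (auto simp: coord_space_def subspace_def)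

lemma coord_space_UNIV: "coord_space UNIV = UNIV"
  by (simp add: coord_space_def)

lemma grad_on_eqI:
  assumes S: "subspace S" and x: "x \<in> S" and g: "g \<in> S"
    and D: "(f has_derivative (\<lambda>h. g \<bullet> h)) (at x within S)"
  shows "grad_on S f x = g"
  unfolding grad_on_def
proof (rule the_equality)
  show "g \<in> S \<and> (f has_derivative (\<lambda>h. g \<bullet> h)) (at x within S)"
    using g D by blast
next
  fix g' assume g': "g' \<in> S \<and> (f has_derivative (\<lambda>h. g' \<bullet> h)) (at x within S)"
  define w where "w = g - g'"
  have w: "w \<in> S"
    unfolding w_def using S g g' by (simp add: subspace_diff)
  have line: "((\<lambda>s::real. x + s *\<^sub>R w) has_derivative (\<lambda>s. s *\<^sub>R w)) (at 0)"
    by (auto intro!: derivative_eq_intros)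
  have img: "range (\<lambda>s::real. x + s *\<^sub>R w) \<subseteq> S"
    using S x w by (auto simp: subspace_add subspace_scale)
  have along: "((\<lambda>s::real. f (x + s *\<^sub>R w)) has_derivative (\<lambda>s. c \<bullet> (s *\<^sub>R w))) (at 0)"
    if c: "(f has_derivative (\<lambda>h. c \<bullet> h)) (at x within S)" for c
  proof (rule has_derivative_in_compose[OF line])
    show "(f has_derivative (\<lambda>h. c \<bullet> h)) (at (x + 0 *\<^sub>R w) within range (\<lambda>s. x + s *\<^sub>R w))"
      using has_derivative_subset[OF c img] by simp
  qed
  have "(\<lambda>s::real. g \<bullet> (s *\<^sub>R w)) = (\<lambda>s. g' \<bullet> (s *\<^sub>R w))"
    using has_derivative_unique along[OF D] along g' by blast
  from fun_cong[OF this, of 1] have "w \<bullet> w = 0"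
    by (simp add: w_def inner_diff_left)
  then show "g' = g" by (simp add: w_def)
qed

end

theory Submission
  imports Defs
begin

text \<open>
  Tracking preserves averages: the mean of \<open>\<nu>\<close> is the aggregate of \<open>x\<close> and the mean of \<open>y\<close> is the
  mean of the local gradients, so the algorithm is an online projected gradient method whose error is
  governed by the consensus errors of \<open>\<nu>\<close> and \<open>y\<close>. These are measured in the sum of the norms of
  the components, in which doubly stochastic matrices are nonexpansive, and over a window of fixed
  length they contract by a constant factor on vectors with mean zero. Summing over time bounds the
  accumulated consensus errors by the accumulated inputs, which are \<open>O (\<alpha> t)\<close> for \<open>\<nu>\<close> and
  \<open>O (\<alpha> t)\<close> plus the consensus error of \<open>\<nu>\<close> plus the gradient change for \<open>y\<close>. The usual regret
  estimate then yields \<open>C * (sqrt T + V\<^sup>p + V\<^sup>g)\<close>, without the weighted variation. As the regret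
  is nonnegative, it splits into three terms in proportion to those of this bound.
\<close>

subsection \<open>Consensus\<close>

definition l1 :: "'a::real_normed_vector ^ 'n \<Rightarrow> real" where
  "l1 z = (\<Sum>i\<in>UNIV. norm (z $ i))"

definition mean :: "'a::real_vector ^ 'n \<Rightarrow> 'a" where
  "mean z = (1 / real CARD('n)) *\<^sub>R (\<Sum>i\<in>UNIV. z $ i)"

definition dev :: "'a::real_vector ^ 'n \<Rightarrow> 'a ^ 'n" where
  "dev z = (\<chi> i. z $ i - mean z)"

text \<open>The Kronecker product of \<open>A\<close> with the identity, acting on stacked
  vectors.\<close>

definition mix :: "real ^ 'n ^ 'n \<Rightarrow> 'a::real_vector ^ 'n \<Rightarrow> 'a ^ 'n" where
  "mix A z = (\<chi> i. \<Sum>j\<in>UNIV. A $ i $ j *\<^sub>R z $ j)"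

text \<open>The transition matrix of the time-varying recursion
  \<open>z (Suc t) = mix (A t) (z t)\<close> from time \<open>k\<close> to time
  \<open>k + m\<close>; later factors stand on the left.\<close>

fun trans_matrix :: "(nat \<Rightarrow> real ^ 'n ^ 'n) \<Rightarrow> nat \<Rightarrow> nat \<Rightarrow> real ^ 'n ^ 'n" where
  "trans_matrix A k 0 = mat 1"
| "trans_matrix A k (Suc m) = A (k + m) ** trans_matrix A k m"

lemma l1_nonneg: "0 \<le> l1 z"
  by (simp add: l1_def sum_nonneg)

lemma l1_add: "l1 (z + w) \<le> l1 z + l1 w"
  unfolding l1_def sum.distrib[symmetric] by (intro sum_mono) (simp add: norm_triangle_ineq)

lemma l1_diff: "l1 (z - w) \<le> l1 z + l1 w"
  unfolding l1_def sum.distrib[symmetric] by (intro sum_mono) (simp add: norm_triangle_ineq4)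

lemma norm_nth_le_l1: "norm (z $ i) \<le> l1 z"
  unfolding l1_def by (rule member_le_sum) auto

lemma norm_le_l1: "norm z \<le> l1 z"
  by (simp add: l1_def norm_vec_def L2_set_le_sum)

lemma l1_le_norm:
  fixes z :: "'a::real_normed_vector ^ 'n"
  shows "l1 z \<le> real CARD('n) * norm z"
  unfolding l1_def
  using sum_bounded_above[of UNIV "\<lambda>i. norm (z $ i)" "norm z"] Finite_Cartesian_Product.norm_nth_le[of z] by auto

lemma norm_mean_le:
  fixes z :: "'a::real_normed_vector ^ 'n"
  shows "real CARD('n) * norm (mean z) \<le> l1 z"
  unfolding mean_def l1_def using norm_sum[of "\<lambda>i. z $ i" UNIV] by simp

lemma sum_dev:
  fixes z :: "'a::real_vector ^ 'n"
  shows "(\<Sum>i\<in>UNIV. dev z $ i) = 0"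
  by (simp add: dev_def mean_def sum_subtractf sum_constant_scaleR del: sum_constant)

lemma dev_add: "dev (z + w) = dev z + dev w"
  by (simp add: dev_def mean_def vec_eq_iff sum.distrib algebra_simps)

lemma l1_dev_le:
  fixes z :: "'a::real_normed_vector ^ 'n"
  shows "l1 (dev z) \<le> 2 * l1 z"
proof -
  have "l1 (dev z) \<le> (\<Sum>i\<in>UNIV. norm (z $ i) + norm (mean z))"
    unfolding l1_def dev_def by (intro sum_mono) (simp add: norm_triangle_ineq4)
  also have "\<dots> = l1 z + real CARD('n) * norm (mean z)"
    by (simp add: l1_def sum.distrib)
  finally show ?thesis using norm_mean_le[of z] by simp
qed

lemma mix_add: "mix A (z + w) = mix A z + mix A w"
  by (simp add: mix_def vec_eq_iff sum.distrib scaleR_add_right)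

lemma mix_mult: "mix (A ** A') z = mix A (mix A' z)"
  by (simp add: mix_def vec_eq_iff matrix_matrix_mult_def scaleR_sum_left scaleR_sum_right)
    (subst sum.swap, simp)

lemma mix_mat_1: "mix (mat 1) z = z"
  by (simp add: mix_def vec_eq_iff mat_def if_distrib[of "\<lambda>c. c *\<^sub>R _"] cong: if_cong)

text \<open>Exchanging the sums leaves the column sums, which are one. Hence mixing cannot disturb a
  tracked average.\<close>

lemma sum_mix:
  assumes "doubly_stochastic A"
  shows "(\<Sum>i\<in>UNIV. mix A z $ i) = (\<Sum>i\<in>UNIV. z $ i)"
proof -
  have "(\<Sum>i\<in>UNIV. mix A z $ i) = (\<Sum>j\<in>UNIV. (\<Sum>i\<in>UNIV. A $ i $ j) *\<^sub>R z $ j)"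
    by (simp add: mix_def scaleR_sum_left) (rule sum.swap)
  then show ?thesis using assms by (simp add: doubly_stochastic_def)
qed

lemma mean_mix: "doubly_stochastic A \<Longrightarrow> mean (mix A z) = mean z"
  by (simp add: mean_def sum_mix)

text \<open>Both halves of double stochasticity enter: column sums keep the mean, row sums fix
  constant vectors.\<close>

lemma dev_mix:
  assumes "doubly_stochastic A"
  shows "dev (mix A z) = mix A (dev z)"
proof -
  have "(\<Sum>j\<in>UNIV. A $ i $ j *\<^sub>R mean z) = mean z" for i
    using assms by (simp add: doubly_stochastic_def flip: scaleR_sum_left)
  then show ?thesis
    using assms unfolding dev_def
    by (simp add: vec_eq_iff mean_mix) (simp add: mix_def scaleR_diff_right sum_subtractf)
qed

text \<open>The column sum is a parameter because the contraction applies the bound to a matrix from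
  which a constant was subtracted, with column sums
  \<open>1 - real CARD('n) * \<eta>\<close>.\<close>

lemma l1_mix_le:
  fixes z :: "'a::real_normed_vector ^ 'n"
  assumes "\<And>i j. 0 \<le> A $ i $ j" and "\<And>j. (\<Sum>i\<in>UNIV. A $ i $ j) = c"
  shows "l1 (mix A z) \<le> c * l1 z"
proof -
  have "l1 (mix A z) \<le> (\<Sum>i\<in>UNIV. \<Sum>j\<in>UNIV. A $ i $ j * norm (z $ j))"
    unfolding l1_def mix_def using assms(1) by (auto intro!: sum_mono norm_sum[THEN order_trans])
  also have "\<dots> = (\<Sum>j\<in>UNIV. (\<Sum>i\<in>UNIV. A $ i $ j) * norm (z $ j))"
    by (subst sum.swap) (simp add: sum_distrib_right)
  also have "\<dots> = c * l1 z"
    by (simp add: assms(2) l1_def sum_distrib_left)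
  finally show ?thesis .
qed

lemma l1_mix_le_ds: "doubly_stochastic A \<Longrightarrow> l1 (mix A z) \<le> l1 z"
  using l1_mix_le[of A 1 z] by (simp add: doubly_stochastic_def)

text \<open>On vectors with mean zero the constant part \<open>\<eta>\<close> of the matrix acts as zero.\<close>

lemma l1_mix_contract:
  fixes A :: "real ^ 'n ^ 'n" and z :: "'a::real_normed_vector ^ 'n"
  assumes "doubly_stochastic A" and \<eta>: "\<And>i j. \<eta> \<le> A $ i $ j" and z: "(\<Sum>i\<in>UNIV. z $ i) = 0"
  shows "l1 (mix A z) \<le> (1 - real CARD('n) * \<eta>) * l1 z"
proof -
  let ?A = "\<chi> i j. A $ i $ j - \<eta>"
  have "mix A z = mix ?A z"
    using z by (simp add: mix_def vec_eq_iff scaleR_left_diff_distrib sum_subtractf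
        flip: scaleR_sum_right)
  moreover have "l1 (mix ?A z) \<le> (1 - real CARD('n) * \<eta>) * l1 z"
    using assms by (intro l1_mix_le) (auto simp: doubly_stochastic_def sum_subtractf)
  ultimately show ?thesis by simp
qed

section \<open>Transition matrices and joint connectivity\<close>

lemma doubly_stochastic_mult:
  assumes "doubly_stochastic A" "doubly_stochastic A'"
  shows "doubly_stochastic (A ** A')"
proof -
  have "(\<Sum>j\<in>UNIV. \<Sum>l\<in>UNIV. A $ i $ l * A' $ l $ j) = 1" for i
    using assms by (subst sum.swap) (simp add: doubly_stochastic_def flip: sum_distrib_left)
  moreover have "(\<Sum>i\<in>UNIV. \<Sum>l\<in>UNIV. A $ i $ l * A' $ l $ j) = 1" for j
    using assms by (subst sum.swap) (simp add: doubly_stochastic_def flip: sum_distrib_right)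
  ultimately show ?thesis
    using assms by (auto simp: doubly_stochastic_def matrix_matrix_mult_def intro!: sum_nonneg)
qed

lemma doubly_stochastic_trans_matrix:
  assumes "\<And>t. doubly_stochastic (A t)"
  shows "doubly_stochastic (trans_matrix A k m)"
proof (induction m)
  case 0
  show ?case by (simp add: doubly_stochastic_def mat_def)
next
  case (Suc m)
  then show ?case using assms by (simp add: doubly_stochastic_mult)
qed

text \<open>A path from \<open>u\<close> to \<open>v\<close> starts inside \<open>R\<close> and ends
  outside it, so one of its arcs leaves \<open>R\<close>.\<close>

lemma digraph_of_crossing_edge:
  assumes "strongly_connected (digraph_of E)" and "u \<in> R" and "v \<notin> R"
  obtains l i where "(l, i) \<in> E" "l \<in> R" "i \<notin> R"
proof -
  have "arcs_ends (digraph_of E) = E"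
    by (auto simp: arcs_ends_def arc_to_ends_def digraph_of_def)
  then have "(u, v) \<in> E\<^sup>*"
    using assms(1) reachable_rtranclI[of "digraph_of E" u v]
    by (auto simp: strongly_connected_def digraph_of_def)
  then have "\<exists>l i. (l, i) \<in> E \<and> l \<in> R \<and> i \<notin> R"
    using assms(2,3) by (induction rule: rtrancl_induct) auto
  then show thesis using that by blast
qed

text \<open>The set of agents \<open>i\<close> reached from \<open>j\<close> with weight at least \<open>a ^ m\<close> within \<open>m\<close> steps never
  shrinks, and it grows within each window of length \<open>Q\<close> until it contains every agent.\<close>

lemma trans_matrix_lower_bound:
  fixes A :: "nat \<Rightarrow> real ^ 'n ^ 'n"
  assumes ds: "\<And>t. doubly_stochastic (A t)"
    and a: "0 < a" "\<And>t i. a \<le> A t $ i $ i" "\<And>t i j. (j, i) \<in> E t \<Longrightarrow> a \<le> A t $ i $ j"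
    and conn: "\<And>k. strongly_connected (digraph_of (\<Union>l<Q. E (k + l)))"
  shows "a ^ (CARD('n) * Q) \<le> trans_matrix A k (CARD('n) * Q) $ i $ j"
proof -
  define R where "R m = {i. a ^ m \<le> trans_matrix A k m $ i $ j}" for m
  have nonneg: "0 \<le> A t $ i $ l" "0 \<le> trans_matrix A k m $ i $ l" for t m i l
    using ds doubly_stochastic_trans_matrix[where A=A, OF ds] by (auto simp: doubly_stochastic_def)
  \<comment> \<open>The path through \<open>l\<close> is a single term of the nonnegative sum
    defining the matrix product.\<close>
  have step: "i \<in> R (Suc m)" if "l \<in> R m" "a \<le> A (k + m) $ i $ l" for i l m
  proof -
    have "a ^ Suc m \<le> A (k + m) $ i $ l * trans_matrix A k m $ l $ j"
      using that a(1) by (auto simp: R_def intro!: mult_mono)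
    also have "\<dots> \<le> trans_matrix A k (Suc m) $ i $ j"
      by (simp add: matrix_matrix_mult_def) (rule member_le_sum; simp add: nonneg)
    finally show ?thesis by (simp add: R_def)
  qed
  then have "R m \<subseteq> R (Suc m)" for m
    using a(2) by blast
  then have R_mono: "R m \<subseteq> R m'" if "m \<le> m'" for m m'
    using that by (rule lift_Suc_mono_le)
  have j0: "j \<in> R 0"
    by (simp add: R_def mat_def)
  have grow: "R m = UNIV \<or> card (R m) < card (R (m + Q))" for m
  proof (cases "R m = UNIV")
    case False
    then obtain v where v: "v \<notin> R m" by blast
    \<comment> \<open>The crossing arc may be active only at time \<open>k + m + q\<close> inside
      the window. By then \<open>l\<close> is still in \<open>R\<close>, so \<open>i\<close> enters
      at step \<open>m + q + 1\<close>, which is at most \<open>m + Q\<close>.\<close>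
    obtain l i where li: "(l, i) \<in> (\<Union>q<Q. E (k + m + q))" "l \<in> R m" "i \<notin> R m"
      using digraph_of_crossing_edge[OF conn _ v] R_mono j0 by blast
    then obtain q where q: "q < Q" "(l, i) \<in> E (k + (m + q))"
      by (auto simp: add.assoc)
    have "i \<in> R (Suc (m + q))"
      using step[of l "m + q" i] a(3)[OF q(2)] li(2) R_mono[of m "m + q"] by auto
    then have "i \<in> R (m + Q)"
      using R_mono[of "Suc (m + q)" "m + Q"] q(1) by auto
    then have "R m \<subset> R (m + Q)"
      using li(3) R_mono[of m "m + Q"] by auto
    then show ?thesis by (simp add: psubset_card_mono)
  qed simp
  \<comment> \<open>Each window adds at least one agent and \<open>R 0\<close> already holds
    \<open>j\<close>, so after \<open>CARD('n)\<close> windows the second alternative would exceed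
    the number of agents.\<close>
  have "R (s * Q) = UNIV \<or> s < card (R (s * Q))" for s
  proof (induction s)
    case 0
    show ?case using j0 by (auto simp: card_gt_0_iff)
  next
    case (Suc s)
    then show ?case
      using grow[of "s * Q"] R_mono[of "s * Q" "s * Q + Q"] by (auto simp: add.commute)
  qed
  from this[of "CARD('n)"] have "R (CARD('n) * Q) = UNIV"
    using card_mono[OF finite subset_UNIV, of "R (CARD('n) * Q)"] by auto
  then show ?thesis by (auto simp: R_def)
qed

section \<open>Mixing with inputs: summed and uniform bounds\<close>

lemma mixing_window:
  fixes A :: "nat \<Rightarrow> real ^ 'n ^ 'n" and z u :: "nat \<Rightarrow> 'a::real_normed_vector ^ 'n"
  assumes ds: "\<And>t. doubly_stochastic (A t)"
    and rec: "\<And>t. z (Suc t) = mix (A t) (z t) + u t"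
  shows "l1 (z (k + m) - mix (trans_matrix A k m) (z k)) \<le> (\<Sum>s=k..<k+m. l1 (u s))"
proof (induction m)
  case 0
  show ?case by (simp add: mix_mat_1 l1_def)
next
  case (Suc m)
  \<comment> \<open>The gap to the input-free evolution obeys the same recursion from the value
    zero, and mixing does not expand it, so the inputs merely add up.\<close>
  have "z (k + Suc m) - mix (trans_matrix A k (Suc m)) (z k) =
      mix (A (k + m)) (z (k + m) - mix (trans_matrix A k m) (z k)) + u (k + m)"
    using mix_add[of "A (k + m)" "z (k + m) - mix (trans_matrix A k m) (z k)"
        "mix (trans_matrix A k m) (z k)"]
    by (simp add: rec mix_mult)
  then show ?case
    using l1_add[of "mix (A (k + m)) (z (k + m) - mix (trans_matrix A k m) (z k))" "u (k + m)"]
      l1_mix_le_ds[OF ds, of "k + m" "z (k + m) - mix (trans_matrix A k m) (z k)"] Suc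
    by simp
qed

text \<open>After summing the recursion over time, the sum of \<open>D\<close> on the right moves to
  the left and gives the factor \<open>1 - \<rho>\<close>; the first \<open>M\<close> values, which
  no window reaches, are paid separately.\<close>

lemma contraction_sum_bound:
  fixes D b :: "nat \<Rightarrow> real"
  assumes D: "\<And>t. 0 \<le> D t" and b: "\<And>t. 0 \<le> b t" and \<rho>: "0 \<le> \<rho>" and M: "M > 0"
    and rec: "\<And>t. D (t + M) \<le> \<rho> * D t + (\<Sum>s=t..<t+M. b s)"
  shows "(1 - \<rho>) * (\<Sum>t<T. D t) \<le> (\<Sum>t<M. D t) + real M * (\<Sum>t<T. b t)"
proof -
  \<comment> \<open>An input lies in at most \<open>M\<close> windows. The range ends at
    \<open>n + M\<close>, which is the horizon \<open>T\<close> below, so no input beyond the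
    horizon is charged.\<close>
  have win: "(\<Sum>t<n. \<Sum>s=t..<t+M. b s) \<le> real M * (\<Sum>t<n + M. b t)" for n
  proof -
    have "(\<Sum>t<n. \<Sum>s=t..<t+M. b s) = (\<Sum>t<n. \<Sum>q<M. b (t + q))"
      using sum.shift_bounds_nat_ivl[of b 0 _ M] by (simp add: lessThan_atLeast0 add.commute)
    also have "\<dots> = (\<Sum>q<M. \<Sum>t<n. b (t + q))"
      by (rule sum.swap)
    also have "\<dots> \<le> (\<Sum>q<M. \<Sum>t<n + M. b t)"
    proof (rule sum_mono)
      fix q assume "q \<in> {..<M}"
      have "(\<Sum>t<n. b (t + q)) = sum b ((\<lambda>t. t + q) ` {..<n})"
        by (simp add: sum.reindex inj_on_def)
      also have "\<dots> \<le> (\<Sum>t<n + M. b t)"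
        using \<open>q \<in> {..<M}\<close> b by (intro sum_mono2) auto
      finally show "(\<Sum>t<n. b (t + q)) \<le> (\<Sum>t<n + M. b t)" .
    qed
    finally show ?thesis by simp
  qed
  have "(\<Sum>t<T. D t) \<le> (\<Sum>t<M. D t) + (\<rho> * (\<Sum>t<T. D t) + real M * (\<Sum>t<T. b t))"
  proof (cases "T \<le> M")
    case True
    then have "(\<Sum>t<T. D t) \<le> (\<Sum>t<M. D t)"
      using D by (intro sum_mono2) auto
    moreover have "0 \<le> \<rho> * (\<Sum>t<T. D t) + real M * (\<Sum>t<T. b t)"
      using \<rho> D b by (intro add_nonneg_nonneg mult_nonneg_nonneg sum_nonneg) auto
    ultimately show ?thesis by simp
  next
    case False
    define n where "n = T - M"
    have T: "T = n + M" using False by (simp add: n_def)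
    have "(\<Sum>t<T. D t) = (\<Sum>t<M. D t) + (\<Sum>t<n. D (t + M))"
      unfolding T by (induction n) auto
    also have "(\<Sum>t<n. D (t + M)) \<le> (\<Sum>t<n. \<rho> * D t + (\<Sum>s=t..<t+M. b s))"
      by (intro sum_mono rec)
    also have "\<dots> = \<rho> * (\<Sum>t<n. D t) + (\<Sum>t<n. \<Sum>s=t..<t+M. b s)"
      by (simp add: sum.distrib sum_distrib_left)
    also have "\<dots> \<le> \<rho> * (\<Sum>t<T. D t) + real M * (\<Sum>t<T. b t)"
      using win[of n] D \<rho> unfolding T
      by (intro add_mono mult_left_mono sum_mono2) auto
    finally show ?thesis by simp
  qed
  then show ?thesis by (simp add: algebra_simps)
qed

lemma contraction_bounded:
  fixes D :: "nat \<Rightarrow> real"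
  assumes \<rho>: "0 \<le> \<rho>" "\<rho> < 1" and M: "M > 0"
    and rec: "\<And>t. D (t + M) \<le> \<rho> * D t + \<beta>"
  shows "\<exists>C. \<forall>t. D t \<le> C"
proof -
  \<comment> \<open>\<open>\<beta> / (1 - \<rho>)\<close> is the fixed point of the recursion, and
    any constant above it is preserved. The first \<open>M\<close> values serve as the base
    case.\<close>
  define C where "C = max (\<beta> / (1 - \<rho>)) (Max (D ` {..<M}))"
  have C: "\<rho> * C + \<beta> \<le> C"
  proof -
    have "\<beta> / (1 - \<rho>) \<le> C" by (simp add: C_def)
    then show ?thesis using \<rho> by (simp add: field_simps)
  qed
  have "D t \<le> C" for t
  proof (induction t rule: less_induct)
    case (less t)
    show ?case
    proof (cases "t < M")
      case True
      then have "D t \<le> Max (D ` {..<M})" by (intro Max_ge) auto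
      then show ?thesis by (simp add: C_def)
    next
      case False
      then have "D t \<le> \<rho> * D (t - M) + \<beta>" using rec[of "t - M"] by simp
      also have "\<dots> \<le> \<rho> * C + \<beta>"
        using less[of "t - M"] False M \<rho> by (intro add_right_mono mult_left_mono) auto
      finally show ?thesis using C by simp
    qed
  qed
  then show ?thesis by blast
qed

text \<open>Over \<open>CARD('n) * Q\<close> steps every entry of the transition matrix is at least
  a fixed positive constant, whatever the starting time, so the rate is uniform in \<open>k\<close>.
  The factor two comes from passing from inputs to their deviations.\<close>

lemma consensus_contraction:
  fixes A :: "nat \<Rightarrow> real ^ 'n ^ 'n" and z u :: "nat \<Rightarrow> 'a::real_normed_vector ^ 'n"
  assumes ds: "\<And>t. doubly_stochastic (A t)"
    and a: "0 < a" "\<And>t i. a \<le> A t $ i $ i" "\<And>t i j. (j, i) \<in> E t \<Longrightarrow> a \<le> A t $ i $ j"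
    and conn: "\<And>k. strongly_connected (digraph_of (\<Union>l<Q. E (k + l)))" and Q: "Q > 0"
    and rec: "\<And>t. z (Suc t) = mix (A t) (z t) + u t"
  obtains M \<rho> where "M > 0" "0 \<le> \<rho>" "\<rho> < 1"
    "\<And>k. l1 (dev (z (k + M))) \<le> \<rho> * l1 (dev (z k)) + (\<Sum>s=k..<k+M. 2 * l1 (u s))"
proof
  define M where "M = CARD('n) * Q"
  define \<rho> where "\<rho> = 1 - real CARD('n) * a ^ M"
  note lower = trans_matrix_lower_bound[where A=A and E=E, OF ds a conn, folded M_def]
  note ds' = doubly_stochastic_trans_matrix[where A=A, OF ds]
  show "M > 0" using Q by (simp add: M_def)
  \<comment> \<open>A row of the transition matrix sums to one and each entry is at least
    \<open>a ^ M\<close>, so \<open>\<rho>\<close> is nonnegative.\<close>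
  have "real CARD('n) * a ^ M \<le> (\<Sum>j\<in>UNIV. trans_matrix A 0 M $ i $ j)" for i
    using sum_bounded_below[of UNIV "a ^ M" "\<lambda>j. trans_matrix A 0 M $ i $ j"] lower by simp
  then show "0 \<le> \<rho>"
    using ds'[where k=0 and m=M] by (simp add: \<rho>_def doubly_stochastic_def)
  show "\<rho> < 1" using a(1) by (simp add: \<rho>_def)
  fix k
  have rec': "dev (z (Suc t)) = mix (A t) (dev (z t)) + dev (u t)" for t
    by (simp add: rec dev_add dev_mix ds)
  let ?h = "mix (trans_matrix A k M) (dev (z k))"
  have "l1 (dev (z (k + M))) \<le> l1 (dev (z (k + M)) - ?h) + l1 ?h"
    using l1_add[of "dev (z (k + M)) - ?h" ?h] by simp
  also have "l1 ?h \<le> \<rho> * l1 (dev (z k))"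
    unfolding \<rho>_def by (rule l1_mix_contract[OF ds' lower sum_dev])
  also have "l1 (dev (z (k + M)) - ?h) \<le> (\<Sum>s=k..<k+M. l1 (dev (u s)))"
    by (rule mixing_window[where A=A and u="\<lambda>t. dev (u t)" and z="\<lambda>t. dev (z t)", OF ds rec'])
  also have "\<dots> \<le> (\<Sum>s=k..<k+M. 2 * l1 (u s))"
    by (intro sum_mono l1_dev_le)
  finally show "l1 (dev (z (k + M))) \<le> \<rho> * l1 (dev (z k)) + (\<Sum>s=k..<k+M. 2 * l1 (u s))"
    by simp
qed

text \<open>The summand \<open>1\<close> lets the contribution of the first window go into the
  constant, which depends on the sequence \<open>z\<close> but not on \<open>T\<close>.\<close>

lemma consensus_sum_bound:
  fixes A :: "nat \<Rightarrow> real ^ 'n ^ 'n" and z u :: "nat \<Rightarrow> 'a::real_normed_vector ^ 'n"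
  assumes "\<And>t. doubly_stochastic (A t)"
    and "0 < a" "\<And>t i. a \<le> A t $ i $ i" "\<And>t i j. (j, i) \<in> E t \<Longrightarrow> a \<le> A t $ i $ j"
    and "\<And>k. strongly_connected (digraph_of (\<Union>l<Q. E (k + l)))" and "Q > 0"
    and "\<And>t. z (Suc t) = mix (A t) (z t) + u t"
  shows "\<exists>C\<ge>0. \<forall>T. (\<Sum>t<T. l1 (dev (z t))) \<le> C * (1 + (\<Sum>t<T. l1 (u t)))"
proof -
  obtain M \<rho> where M: "M > 0" and \<rho>: "0 \<le> \<rho>" "\<rho> < 1"
    and c: "\<And>k. l1 (dev (z (k + M))) \<le> \<rho> * l1 (dev (z k)) + (\<Sum>s=k..<k+M. 2 * l1 (u s))"
    using consensus_contraction[where A=A and E=E and z=z and u=u, OF assms] by blast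
  define S where "S = (\<Sum>t<M. l1 (dev (z t)))"
  have S: "0 \<le> S" by (simp add: S_def sum_nonneg l1_nonneg)
  have "(\<Sum>t<T. l1 (dev (z t))) \<le> (S + 2 * M) / (1 - \<rho>) * (1 + (\<Sum>t<T. l1 (u t)))" for T
  proof -
    let ?U = "\<Sum>t<T. l1 (u t)"
    have U: "0 \<le> ?U" by (simp add: sum_nonneg l1_nonneg)
    have "(1 - \<rho>) * (\<Sum>t<T. l1 (dev (z t))) \<le> S + real M * (\<Sum>t<T. 2 * l1 (u t))"
      unfolding S_def by (rule contraction_sum_bound[OF _ _ \<rho>(1) M c]) (simp_all add: l1_nonneg)
    also have "\<dots> \<le> (S + 2 * M) * (1 + ?U)"
      using S U by (simp add: algebra_simps flip: sum_distrib_left)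
    finally show ?thesis using \<rho> by (simp add: field_simps)
  qed
  then show ?thesis using S \<rho> by (intro exI[of _ "(S + 2 * M) / (1 - \<rho>)"]) simp
qed

text \<open>Summed bounds do not control single times uniformly. A uniform bound is needed for
  \<open>y\<close>, whose size must be controlled before the steps of \<open>x\<close> can
  be.\<close>

lemma consensus_bounded:
  fixes A :: "nat \<Rightarrow> real ^ 'n ^ 'n" and z u :: "nat \<Rightarrow> 'a::real_normed_vector ^ 'n"
  assumes "\<And>t. doubly_stochastic (A t)"
    and "0 < a" "\<And>t i. a \<le> A t $ i $ i" "\<And>t i j. (j, i) \<in> E t \<Longrightarrow> a \<le> A t $ i $ j"
    and "\<And>k. strongly_connected (digraph_of (\<Union>l<Q. E (k + l)))" and "Q > 0"
    and "\<And>t. z (Suc t) = mix (A t) (z t) + u t"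
    and \<beta>: "\<And>t. l1 (u t) \<le> \<beta>"
  shows "\<exists>C. \<forall>t. l1 (dev (z t)) \<le> C"
proof -
  obtain M \<rho> where M: "M > 0" and \<rho>: "0 \<le> \<rho>" "\<rho> < 1"
    and c: "\<And>k. l1 (dev (z (k + M))) \<le> \<rho> * l1 (dev (z k)) + (\<Sum>s=k..<k+M. 2 * l1 (u s))"
    using consensus_contraction[where A=A and E=E and z=z and u=u, OF assms(1-7)] by blast
  have "(\<Sum>s=k..<k+M. 2 * l1 (u s)) \<le> real M * (2 * \<beta>)" for k
    using sum_bounded_above[of "{k..<k+M}" "\<lambda>s. 2 * l1 (u s)" "2 * \<beta>"] \<beta> by simp
  then show ?thesis
    using c by (intro contraction_bounded[OF \<rho> M, of _ "real M * (2 * \<beta>)"]) (smt (verit))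
qed

subsection \<open>Gradients on subspaces\<close>

text \<open>The vector representing \<open>D\<close> on the ambient space may leave
  \<open>S\<close>. Its orthogonal projection to \<open>S\<close> represents \<open>D\<close> on
  directions in \<open>S\<close>, the only ones that a derivative within \<open>S\<close>
  sees.\<close>

lemma grad_on_works:
  fixes S :: "'a::euclidean_space set"
  assumes S: "subspace S" and x: "x \<in> S" and D: "(f has_derivative D) (at x within S)"
  shows "grad_on S f x \<in> S" and "(f has_derivative (\<lambda>h. grad_on S f x \<bullet> h)) (at x within S)"
    and "\<And>h. h \<in> S \<Longrightarrow> D h = grad_on S f x \<bullet> h"
proof -
  interpret D: bounded_linear D using D by (rule has_derivative_bounded_linear)
  obtain g w where g: "g \<in> span S" and w: "\<And>h. h \<in> span S \<Longrightarrow> orthogonal w h"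
    and gw: "adjoint D 1 = g + w"
    using orthogonal_subspace_decomp_exists[of S "adjoint D 1"] by metis
  have gS: "g \<in> S" using g S by (metis span_eq_iff)
  have Dg: "D h = g \<bullet> h" if "h \<in> S" for h
  proof -
    have "D h = adjoint D 1 \<bullet> h"
      using adjoint_works[OF D.linear, of h 1] by (simp add: inner_commute)
    then show ?thesis
      using w[of h] span_base[OF that] by (simp add: gw inner_add_left orthogonal_def)
  qed
  have "(f has_derivative (\<lambda>h. g \<bullet> h)) (at x within S)"
    unfolding has_derivative_within
  proof (intro conjI bounded_linear_inner_right)
    have "((\<lambda>z. (1 / norm (z - x)) *\<^sub>R (f z - (f x + D (z - x)))) \<longlongrightarrow> 0) (at x within S)"
      using D by (simp add: has_derivative_within)
    then show "((\<lambda>z. (1 / norm (z - x)) *\<^sub>R (f z - (f x + g \<bullet> (z - x)))) \<longlongrightarrow> 0) (at x within S)"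
      by (rule Lim_transform_within[OF _ zero_less_one]) (simp add: Dg subspace_diff[OF S] x)
  qed
  moreover from this have "grad_on S f x = g"
    by (rule grad_on_eqI[OF S x gS])
  ultimately show "grad_on S f x \<in> S"
    "(f has_derivative (\<lambda>h. grad_on S f x \<bullet> h)) (at x within S)"
    "\<And>h. h \<in> S \<Longrightarrow> D h = grad_on S f x \<bullet> h"
    using gS Dg by auto
qed

lemma jacobian_T_works:
  fixes \<psi> :: "real ^ 'm::finite \<Rightarrow> real ^ 'd::finite"
  assumes v: "v \<in> coord_space K" and D: "(\<psi> has_derivative D) (at v within coord_space K)"
  shows "(\<psi> has_derivative (\<lambda>h. transpose (jacobian_T K \<psi> v) *v h)) (at v within coord_space K)"
    and "\<And>h. h \<in> coord_space K \<Longrightarrow> D h = transpose (jacobian_T K \<psi> v) *v h"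
proof -
  have row: "(transpose (jacobian_T K \<psi> v) *v h) $ l = grad_on (coord_space K) (\<lambda>u. \<psi> u $ l) v \<bullet> h"
    for h l
    by (simp add: jacobian_T_def matrix_vector_mult_def inner_vec_def)
  have Dl: "((\<lambda>u. \<psi> u $ l) has_derivative (\<lambda>h. D h $ l)) (at v within coord_space K)" for l
    using D bounded_linear.has_derivative bounded_linear_vec_nth by blast
  note works = grad_on_works[OF subspace_coord_space v Dl]
  show "(\<psi> has_derivative (\<lambda>h. transpose (jacobian_T K \<psi> v) *v h)) (at v within coord_space K)"
    using works(2)
    by (subst has_derivative_componentwise_within) (auto simp: Basis_vec_def inner_axis row simp del: transpose_matrix_vector)
  show "D h = transpose (jacobian_T K \<psi> v) *v h" if "h \<in> coord_space K" for h
    using works(3)[OF that] by (simp add: vec_eq_iff row del: transpose_matrix_vector)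
qed

section \<open>Induced norms and Lipschitz bounds\<close>

lemma norm_matrix_vector_le: "norm (M *v z) \<le> mat_norm M * norm z"
  for M :: "real ^ 'd::finite ^ 'm::finite"
  unfolding mat_norm_def by (rule onorm[OF matrix_vector_mul_bounded_linear])

text \<open>The squared norm of \<open>z = transpose M *v h\<close> is the inner product of
  \<open>M *v z\<close> with \<open>h\<close>, and one factor \<open>norm z\<close> cancels. This
  transfers the bound \<open>G\<close>, assumed for \<open>jacobian_T\<close>, to its transpose,
  which is the actual derivative.\<close>

lemma mat_norm_transpose_le:
  fixes M :: "real ^ 'd::finite ^ 'm::finite"
  shows "mat_norm (transpose M) \<le> mat_norm M"
  unfolding mat_norm_def[of "transpose M"]
proof (rule onorm_le)
  fix h
  define z where "z = transpose M *v h"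
  have "norm z * norm z = (M *v z) \<bullet> h"
    using dot_lmul_matrix[of h M z]
    by (simp add: z_def transpose_matrix_vector inner_commute flip: norm_eq_square power2_eq_square power2_norm_eq_inner)
  also have "\<dots> \<le> norm (M *v z) * norm h" by (rule norm_cauchy_schwarz)
  also have "\<dots> \<le> mat_norm M * norm z * norm h"
    by (intro mult_right_mono norm_matrix_vector_le) simp
  finally have "norm z * norm z \<le> (mat_norm M * norm h) * norm z" by (simp add: ac_simps)
  moreover have "0 \<le> mat_norm M"
    by (simp add: mat_norm_def onorm_pos_le)
  ultimately have "norm z \<le> mat_norm M * norm h"
    by (cases "z = 0") auto
  then show "norm (transpose M *v h) \<le> mat_norm M * norm h" by (simp add: z_def)
qed

lemma lipschitz_of_jacobian_bound:
  fixes \<psi> :: "real ^ 'm::finite \<Rightarrow> real ^ 'd::finite"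
  assumes "\<psi> differentiable_on coord_space K" "S \<subseteq> coord_space K" "convex S"
    and "\<And>v. v \<in> S \<Longrightarrow> mat_norm (jacobian_T K \<psi> v) \<le> G"
    and "v \<in> S" "v' \<in> S"
  shows "norm (\<psi> v - \<psi> v') \<le> G * norm (v - v')"
proof (rule differentiable_bound[OF \<open>convex S\<close> _ _ \<open>v \<in> S\<close> \<open>v' \<in> S\<close>])
  fix w assume w: "w \<in> S"
  obtain D where "(\<psi> has_derivative D) (at w within coord_space K)"
    using assms(1,2) w unfolding differentiable_on_def differentiable_def by blast
  from jacobian_T_works(1)[OF _ this]
  show "(\<psi> has_derivative (\<lambda>h. transpose (jacobian_T K \<psi> w) *v h)) (at w within S)"
    using assms(2) w by (auto intro: has_derivative_subset)
  show "onorm (\<lambda>h. transpose (jacobian_T K \<psi> w) *v h) \<le> G"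
    using mat_norm_transpose_le[of "jacobian_T K \<psi> w"] assms(4)[OF w] by (simp add: mat_norm_def)
qed

text \<open>Convexity is known only for the total loss, so the tangent inequality is taken along the
  line through \<open>x\<close> and \<open>u\<close>, on which the chain rule yields the slope. The
  mean of the second gradients appears because all agents see the same change of the
  aggregate.\<close>

lemma total_loss_above_tangent:
  fixes f :: "nat \<Rightarrow> 'n::finite \<Rightarrow> real ^ 'm::finite \<Rightarrow> real ^ 'd::finite \<Rightarrow> real"
  assumes psi: "\<And>i. \<psi> i differentiable_on coord_space (K i)"
    and f: "\<And>t i. (\<lambda>(v, z). f t i v z) differentiable_on coord_space (K i) \<times> UNIV"
    and conv: "convex_on (stacked (\<lambda>i. coord_space (K i))) (total_loss f \<psi> t)"
    and x: "\<And>i. x $ i \<in> coord_space (K i)" and u: "\<And>i. u $ i \<in> coord_space (K i)"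
  defines "w \<equiv> (\<chi> i. aggregate \<psi> x)"
  shows "total_loss f \<psi> t x - total_loss f \<psi> t u \<le>
    (\<Sum>i\<in>UNIV. (grad1 K f t x w $ i + jacobian_T (K i) (\<psi> i) (x $ i) *v mean (grad2 f t x w))
       \<bullet> (x $ i - u $ i))"
proof -
  let ?C = "\<lambda>i. coord_space (K i)"
  let ?J = "\<lambda>i. jacobian_T (K i) (\<psi> i) (x $ i)"
  let ?g1 = "grad1 K f t x w" and ?g2 = "grad2 f t x w"
  define h where "h = u - x"
  have h: "h $ i \<in> ?C i" for i
    by (simp add: h_def subspace_diff[OF subspace_coord_space] u x)
  define \<gamma> where "\<gamma> s = x + s *\<^sub>R h" for s
  have \<gamma>0: "\<gamma> 0 = x" by (simp add: \<gamma>_def)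
  have \<gamma>C: "\<gamma> s $ i \<in> ?C i" for s i
    by (simp add: \<gamma>_def subspace_add[OF subspace_coord_space] subspace_scale[OF subspace_coord_space] x h)
  have \<gamma>': "((\<lambda>s. \<gamma> s $ i) has_derivative (\<lambda>s. s *\<^sub>R h $ i)) (at 0)" for i
    unfolding \<gamma>_def by (auto intro!: derivative_eq_intros)
  have psi': "((\<lambda>s. \<psi> i (\<gamma> s $ i)) has_derivative (\<lambda>s. s *\<^sub>R (transpose (?J i) *v h $ i))) (at 0)" for i
  proof -
    obtain D where "(\<psi> i has_derivative D) (at (x $ i) within ?C i)"
      using psi x unfolding differentiable_on_def differentiable_def by blast
    from jacobian_T_works(1)[OF x this]
    have "(\<psi> i has_derivative (\<lambda>h. transpose (?J i) *v h)) (at (\<gamma> 0 $ i) within range (\<lambda>s. \<gamma> s $ i))"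
      using \<gamma>C by (auto simp: \<gamma>_def intro: has_derivative_subset)
    from has_derivative_in_compose[OF \<gamma>' this] show ?thesis
      by (simp add: matrix_vector_mult_scaleR)
  qed
  define c where "c = (1 / real CARD('n)) *\<^sub>R (\<Sum>i\<in>UNIV. transpose (?J i) *v h $ i)"
  have agg': "((\<lambda>s. aggregate \<psi> (\<gamma> s)) has_derivative (\<lambda>s. s *\<^sub>R c)) (at 0)"
    unfolding aggregate_def c_def
    by (rule has_derivative_eq_rhs, (rule derivative_intros psi')+)
      (auto simp: fun_eq_iff scaleR_sum_right)
  have f': "((\<lambda>s. f t i (\<gamma> s $ i) (aggregate \<psi> (\<gamma> s))) has_derivative
      (\<lambda>s. s * (?g1 $ i \<bullet> h $ i + ?g2 $ i \<bullet> c))) (at 0)" for i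
  proof -
    let ?p = "(x $ i, aggregate \<psi> x)"
    obtain D where D: "((\<lambda>(v, z). f t i v z) has_derivative D) (at ?p within ?C i \<times> UNIV)"
      using f x unfolding differentiable_on_def differentiable_def by blast
    interpret D: bounded_linear D using D by (rule has_derivative_bounded_linear)
    \<comment> \<open>Fixing one argument at a time identifies the two parts of the joint derivative
      \<open>D\<close> with the gradients in \<open>grad1\<close> and \<open>grad2\<close>;
      \<open>D\<close> itself handles the joint motion along the line.\<close>
    have "((\<lambda>v. (v, aggregate \<psi> x)) has_derivative (\<lambda>v. (v, 0))) (at (x $ i) within ?C i)"
      by (auto intro!: derivative_eq_intros)
    from has_derivative_in_compose[OF this has_derivative_subset[OF D]]
    have "((\<lambda>v. f t i v (aggregate \<psi> x)) has_derivative (\<lambda>v. D (v, 0))) (at (x $ i) within ?C i)"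
      by auto
    note D1 = grad_on_works(3)[OF subspace_coord_space x this h]
    have "((\<lambda>z. (x $ i, z)) has_derivative (\<lambda>z. (0, z))) (at (aggregate \<psi> x))"
      by (auto intro!: derivative_eq_intros)
    from has_derivative_in_compose[OF this has_derivative_subset[OF D]]
    have "((\<lambda>z. f t i (x $ i) z) has_derivative (\<lambda>z. D (0, z))) (at (aggregate \<psi> x))"
      using x by auto
    note D2 = grad_on_works(3)[OF subspace_UNIV _ this]
    have "((\<lambda>s. (\<gamma> s $ i, aggregate \<psi> (\<gamma> s))) has_derivative (\<lambda>s. (s *\<^sub>R h $ i, s *\<^sub>R c))) (at 0)"
      by (intro has_derivative_Pair \<gamma>' agg')
    moreover have "((\<lambda>(v, z). f t i v z) has_derivative D) (at (\<gamma> 0 $ i, aggregate \<psi> (\<gamma> 0))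
        within range (\<lambda>s. (\<gamma> s $ i, aggregate \<psi> (\<gamma> s))))"
      using has_derivative_subset[OF D, of "range (\<lambda>s. (\<gamma> s $ i, aggregate \<psi> (\<gamma> s)))"] \<gamma>C
      by (auto simp: \<gamma>0)
    ultimately have "((\<lambda>s. f t i (\<gamma> s $ i) (aggregate \<psi> (\<gamma> s))) has_derivative
        (\<lambda>s. D (s *\<^sub>R h $ i, s *\<^sub>R c))) (at 0)"
      using has_derivative_in_compose by fastforce
    moreover have "D (s *\<^sub>R h $ i, s *\<^sub>R c) = s * (?g1 $ i \<bullet> h $ i + ?g2 $ i \<bullet> c)" for s
    proof -
      have "D (s *\<^sub>R h $ i, s *\<^sub>R c) = s *\<^sub>R (D (h $ i, 0) + D (0, c))"
        using D.scaleR[of s "(h $ i, c)"] by (simp flip: D.add)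
      then show ?thesis using D1 D2[of c] by (simp add: grad1_def grad2_def w_def)
    qed
    ultimately show ?thesis by simp
  qed
  define d where "d = (\<Sum>i\<in>UNIV. ?g1 $ i \<bullet> h $ i + ?g2 $ i \<bullet> c)"
  have "((\<lambda>s. total_loss f \<psi> t (\<gamma> s)) has_field_derivative d) (at 0)"
    unfolding total_loss_def has_field_derivative_def d_def
    by (rule has_derivative_eq_rhs, (rule derivative_intros f')+)
      (simp only: fun_eq_iff mult.commute[of "sum _ _"] sum_distrib_left simp_thms)
  moreover have "convex_on UNIV (\<lambda>s. total_loss f \<psi> t (\<gamma> s))"
  proof (rule convex_onI)
    fix s r r' :: real assume s: "0 < s" "s < 1"
    have "\<gamma> ((1 - s) *\<^sub>R r + s *\<^sub>R r') = (1 - s) *\<^sub>R \<gamma> r + s *\<^sub>R \<gamma> r'"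
      by (simp add: \<gamma>_def algebra_simps)
    then show "total_loss f \<psi> t (\<gamma> ((1 - s) *\<^sub>R r + s *\<^sub>R r')) \<le>
        (1 - s) * total_loss f \<psi> t (\<gamma> r) + s * total_loss f \<psi> t (\<gamma> r')"
      using convex_onD[OF conv, of s "\<gamma> r" "\<gamma> r'"] s \<gamma>C by (simp add: stacked_def)
  qed simp
  ultimately have "d * (1 - 0) \<le> total_loss f \<psi> t (\<gamma> 1) - total_loss f \<psi> t (\<gamma> 0)"
    by (intro convex_on_imp_above_tangent[of UNIV]) auto
  moreover have "d = - (\<Sum>i\<in>UNIV. (?g1 $ i + ?J i *v mean ?g2) \<bullet> (x $ i - u $ i))"
  proof -
    \<comment> \<open>The factor \<open>1 / real CARD('n)\<close> moves from \<open>c\<close> to the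
      gradients, whose sum becomes a mean; transposition then carries each Jacobian across the inner
      product.\<close>
    have "(\<Sum>i\<in>UNIV. ?g2 $ i \<bullet> c) = mean ?g2 \<bullet> (\<Sum>i\<in>UNIV. transpose (?J i) *v h $ i)"
      by (simp add: mean_def c_def inner_sum_left sum_divide_distrib)
    also have "\<dots> = (\<Sum>i\<in>UNIV. (?J i *v mean ?g2) \<bullet> h $ i)"
      by (simp add: inner_sum_right transpose_matrix_vector inner_commute[of "mean _"] dot_lmul_matrix)
        (simp add: inner_commute)
    finally have "d = (\<Sum>i\<in>UNIV. (?g1 $ i + ?J i *v mean ?g2) \<bullet> h $ i)"
      by (simp add: d_def sum.distrib inner_add_left)
    then show ?thesis
      by (simp add: h_def inner_diff_right flip: sum_negf)
  qed
  ultimately show ?thesis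
    by (simp add: \<gamma>_def h_def)
qed

subsection \<open>Analysis of the algorithm\<close>

lemma norm_vec_power2: "(norm z)\<^sup>2 = (\<Sum>i\<in>UNIV. (norm (z $ i))\<^sup>2)"
  for z :: "'a::real_inner ^ 'n"
  by (simp add: power2_norm_eq_inner inner_vec_def)

lemma weighted_telescope_le:
  fixes w p :: "nat \<Rightarrow> real"
  assumes p: "\<And>t. 0 \<le> p t" "\<And>t. p t \<le> P" and w: "\<And>t. 0 \<le> w t" "\<And>t. w t \<le> w (Suc t)"
  shows "(\<Sum>t=1..T. w t * (p t - p (Suc t))) \<le> w T * P"
proof -
  \<comment> \<open>Strengthened for the induction: raising the weight to \<open>w (Suc T)\<close>
    is harmless because \<open>P - p (Suc T)\<close> is nonnegative, and the terms with
    \<open>p (Suc T)\<close> then cancel.\<close>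
  have "(\<Sum>t=1..T. w t * (p t - p (Suc t))) \<le> w T * (P - p (Suc T))"
  proof (induction T)
    case 0
    show ?case using p w by simp
  next
    case (Suc T)
    have "w T * (P - p (Suc T)) \<le> w (Suc T) * (P - p (Suc T))"
      using p w by (intro mult_right_mono) auto
    then show ?case using Suc by (simp add: algebra_simps)
  qed
  also have "\<dots> \<le> w T * P"
    using p w by (intro mult_left_mono) auto
  finally show ?thesis .
qed

lemma sum_inverse_sqrt_le: "(\<Sum>t=1..T. 1 / sqrt (real t)) \<le> 2 * sqrt (real T)"
proof (induction T)
  case (Suc T)
  define r s where "r = sqrt (real T)" and "s = sqrt (real (Suc T))"
  have s: "0 < s" "s * s = real T + 1" "r * r = real T" "r \<le> s"
    by (auto simp: r_def s_def)
  \<comment> \<open>This gives \<open>1 / s \<le> 2 * s - 2 * r\<close>, using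
    \<open>s * s - r * r = 1\<close>; these increments of twice the square root telescope.\<close>
  have "0 \<le> (s - r)\<^sup>2" by simp
  then have "2 * (s * r) \<le> s * s + r * r" by (simp add: power2_eq_square algebra_simps)
  then have "1 \<le> (2 * s - 2 * r) * s" using s by (simp add: algebra_simps)
  then have "1 / s \<le> 2 * s - 2 * r" using s by (simp add: field_simps)
  then show ?case using Suc by (simp add: r_def s_def)
qed simp

text \<open>Tracking sums start at time 0, regret sums at time 1; the nonnegative term at 0 bridges
  the two.\<close>

lemma sum_le_lessThan_Suc:
  fixes h :: "nat \<Rightarrow> real"
  assumes "\<And>t. 0 \<le> h t"
  shows "(\<Sum>t=1..T. h t) \<le> (\<Sum>t<Suc T. h t)"
  using assms by (intro sum_mono2) auto

text \<open>Projection is nonexpansive and fixes \<open>u\<close>, so the new distance to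
  \<open>u\<close> is at most that before projecting; expanding its square isolates the inner
  product.\<close>

lemma projected_step_inner_le:
  fixes S :: "'a::euclidean_space set"
  assumes S: "convex S" "closed S" and u: "u \<in> S" and \<alpha>: "0 < \<alpha>"
  shows "d \<bullet> (v - u) \<le>
    ((norm (v - u))\<^sup>2 - (norm (closest_point S (v - \<alpha> *\<^sub>R d) - u))\<^sup>2) / (2 * \<alpha>) + \<alpha> / 2 * (norm d)\<^sup>2"
proof -
  let ?v' = "closest_point S (v - \<alpha> *\<^sub>R d)"
  have "norm (?v' - u) \<le> norm ((v - u) - \<alpha> *\<^sub>R d)"
    using closest_point_lipschitz[OF S, of "v - \<alpha> *\<^sub>R d" u] u
    by (auto simp: closest_point_self dist_norm algebra_simps)
  then have "(norm (?v' - u))\<^sup>2 \<le> (norm ((v - u) - \<alpha> *\<^sub>R d))\<^sup>2"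
    by (intro power_mono) auto
  also have "\<dots> = (norm (v - u))\<^sup>2 - 2 * \<alpha> * (d \<bullet> (v - u)) + \<alpha>\<^sup>2 * (norm d)\<^sup>2"
    unfolding power2_norm_eq_inner
    by (simp add: inner_diff_left inner_diff_right inner_commute power2_eq_square algebra_simps)
  finally show ?thesis using \<alpha> by (simp add: field_simps power2_eq_square)
qed

section \<open>Setting, tracking invariants and bounds on the iterates\<close>

locale odgt =
  fixes K :: "'n::finite \<Rightarrow> 'm::finite set"
    and X :: "'n \<Rightarrow> (real ^ 'm) set"
    and \<psi> :: "'n \<Rightarrow> real ^ 'm \<Rightarrow> real ^ 'd::finite"
    and f :: "nat \<Rightarrow> 'n \<Rightarrow> real ^ 'm \<Rightarrow> real ^ 'd \<Rightarrow> real"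
    and E :: "nat \<Rightarrow> ('n \<times> 'n) set"
    and A :: "nat \<Rightarrow> real ^ 'n ^ 'n"
    and \<alpha> :: "nat \<Rightarrow> real"
    and x xopt :: "nat \<Rightarrow> real ^ 'm ^ 'n"
    and \<nu> y :: "nat \<Rightarrow> real ^ 'd ^ 'n"
    and B L G a :: real and Q :: nat
  assumes X_sub: "X i \<subseteq> coord_space (K i)"
    and psi_diff: "\<psi> i differentiable_on coord_space (K i)"
    and f_diff: "(\<lambda>(v, z). f t i v z) differentiable_on coord_space (K i) \<times> UNIV"
    and X_sets: "X i \<noteq> {}" "convex (X i)" "compact (X i)"
    and B_pos: "B > 0" and B: "v \<in> X i \<Longrightarrow> norm v \<le> B"
    and loss_convex: "convex_on (stacked (\<lambda>i. coord_space (K i))) (total_loss f \<psi> t)"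
    and L_nonneg: "L \<ge> 0"
    and grad1_lipschitz: "\<lbrakk>u \<in> stacked X; u' \<in> stacked X\<rbrakk> \<Longrightarrow>
          norm (grad1 K f t u w - grad1 K f t u' w') \<le> L * (norm (u - u') + norm (w - w'))"
    and grad2_lipschitz: "\<lbrakk>u \<in> stacked X; u' \<in> stacked X\<rbrakk> \<Longrightarrow>
          norm (grad2 f t u w - grad2 f t u' w') \<le> L * (norm (u - u') + norm (w - w'))"
    and G_pos: "G > 0"
    and norm_grad1: "u \<in> stacked X \<Longrightarrow> norm (grad1 K f t u w) \<le> G"
    and norm_grad2: "u \<in> stacked X \<Longrightarrow> norm (grad2 f t u w) \<le> G"
    and norm_jacobian: "v \<in> X i \<Longrightarrow> mat_norm (jacobian_T (K i) (\<psi> i) v) \<le> G"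
    and Q_pos: "Q > 0"
    and conn: "strongly_connected (digraph_of (\<Union>l<Q. E (k + l)))"
    and A_ds: "doubly_stochastic (A t)"
    and a_pos: "0 < a"
    and A_diag: "a \<le> A t $ i $ i"
    and A_edge: "(j, i) \<in> E t \<Longrightarrow> a \<le> A t $ i $ j"
    and alpha: "\<alpha> 0 = 1" "t \<ge> 1 \<Longrightarrow> \<alpha> t = 1 / sqrt (real t)"
    and run: "odgt_run K X \<psi> f A \<alpha> x \<nu> y"
    and xopt: "is_arg_min (total_loss f \<psi> t) (\<lambda>u. u \<in> stacked X) (xopt t)"
begin

definition g :: "nat \<Rightarrow> real ^ 'd ^ 'n" where
  "g t = grad2 f t (x t) (\<nu> t)"

text \<open>The direction actually followed: a gradient with local estimates in place of the true
  aggregate and of the mean of the second gradients.\<close>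

definition d :: "nat \<Rightarrow> 'n \<Rightarrow> real ^ 'm" where
  "d t i = grad1 K f t (x t) (\<nu> t) $ i + jacobian_T (K i) (\<psi> i) (x t $ i) *v (y t $ i)"

lemma alpha_pos: "0 < \<alpha> t"
  using alpha by (cases t) auto

lemma x_Suc: "x (Suc t) $ i = closest_point (X i) (x t $ i - \<alpha> t *\<^sub>R d t i)"
  using run by (simp add: odgt_run_def d_def)

lemma x_mem: "x t $ i \<in> X i"
proof (cases t)
  case 0
  then show ?thesis using run by (simp add: odgt_run_def)
next
  case (Suc s)
  then show ?thesis by (simp add: x_Suc closest_point_in_set X_sets compact_imp_closed)
qed

lemma x_stacked: "x t \<in> stacked X"
  by (simp add: stacked_def x_mem)

lemma xopt_stacked: "xopt t \<in> stacked X"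
  using xopt by (simp add: is_arg_min_def)

lemma xopt_le: "u \<in> stacked X \<Longrightarrow> total_loss f \<psi> t (xopt t) \<le> total_loss f \<psi> t u"
  using xopt by (auto simp: is_arg_min_def not_less)

lemma norm_diff_le: "\<lbrakk>v \<in> X i; v' \<in> X i\<rbrakk> \<Longrightarrow> norm (v - v') \<le> 2 * B"
  using norm_triangle_ineq4[of v v'] B[of v i] B[of v' i] by simp

lemma norm_stacked_diff_le:
  assumes "u \<in> stacked X" "u' \<in> stacked X"
  shows "norm (u - u') \<le> real CARD('n) * (2 * B)"
proof -
  have "norm (u $ i - u' $ i) \<le> 2 * B" for i
    using assms by (intro norm_diff_le) (auto simp: stacked_def)
  then have bound: "(\<Sum>i\<in>UNIV. norm (u $ i - u' $ i)) \<le> of_nat CARD('n) * (2 * B)"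
    by (intro sum_bounded_above)
  have "norm (u - u') \<le> (\<Sum>i\<in>UNIV. norm (u $ i - u' $ i))"
    using norm_le_l1[of "u - u'"] by (simp add: l1_def)
  also have "\<dots> \<le> real CARD('n) * (2 * B)"
    using bound by simp
  finally show ?thesis .
qed

lemma nu_Suc: "\<nu> (Suc t) = mix (A t) (\<nu> t) + (\<chi> i. \<psi> i (x (Suc t) $ i) - \<psi> i (x t $ i))"
  using run by (simp add: odgt_run_def vec_eq_iff mix_def)

lemma y_Suc: "y (Suc t) = mix (A t) (y t) + (g (Suc t) - g t)"
  using run by (simp add: odgt_run_def vec_eq_iff mix_def g_def)

text \<open>True at time 0 by the initialization; afterwards mixing keeps the sum and the added
  differences of \<open>\<psi>\<close> telescope.\<close>

lemma mean_nu: "mean (\<nu> t) = aggregate \<psi> (x t)"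
proof (induction t)
  case 0
  show ?case using run by (simp add: odgt_run_def mean_def aggregate_def)
next
  case (Suc t)
  then show ?case
    using A_ds by (simp add: nu_Suc mean_def aggregate_def sum.distrib sum_mix sum_subtractf)
qed

lemma mean_y: "mean (y t) = mean (g t)"
proof (induction t)
  case 0
  show ?case using run by (simp add: odgt_run_def mean_def g_def)
next
  case (Suc t)
  then show ?case
    using A_ds by (simp add: y_Suc mean_def sum.distrib sum_mix sum_subtractf)
qed

lemma l1_g_le: "l1 (g t) \<le> real CARD('n) * G"
  unfolding g_def
  by (rule order_trans[OF l1_le_norm]) (intro mult_left_mono norm_grad2 x_stacked, simp)

text \<open>Bounded gradients give bounded inputs to the recursion of \<open>y\<close>, hence
  bounded deviations; the mean is a mean of gradients, so its norm is at most
  \<open>G\<close>.\<close>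

lemma y_bounded: "\<exists>Y\<ge>0. \<forall>t i. norm (y t $ i) \<le> Y"
proof -
  have "l1 (g (Suc t) - g t) \<le> 2 * (real CARD('n) * G)" for t
    using l1_diff[of "g (Suc t)" "g t"] l1_g_le[of t] l1_g_le[of "Suc t"] by simp
  then obtain C where C: "\<And>t. l1 (dev (y t)) \<le> C"
    using consensus_bounded[where A=A and E=E and z=y, OF A_ds a_pos A_diag A_edge conn Q_pos y_Suc] by blast
  have "norm (y t $ i) \<le> C + G" for t i
  proof -
    have "real CARD('n) * norm (mean (g t)) \<le> real CARD('n) * G"
      using norm_mean_le l1_g_le by (rule order_trans)
    then have "norm (mean (y t)) \<le> G" by (simp add: mean_y)
    moreover have "norm (dev (y t) $ i) \<le> C"
      using norm_nth_le_l1 C by (rule order_trans)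
    moreover have "y t $ i = dev (y t) $ i + mean (y t)" by (simp add: dev_def)
    ultimately show ?thesis
      using norm_triangle_ineq[of "dev (y t) $ i" "mean (y t)"] by simp
  qed
  then show ?thesis
    using norm_ge_zero order_trans by blast
qed

lemma d_bounded: "\<exists>D\<ge>0. \<forall>t i. norm (d t i) \<le> D"
proof -
  obtain Y where Y: "0 \<le> Y" "\<And>t i. norm (y t $ i) \<le> Y"
    using y_bounded by blast
  have "norm (d t i) \<le> G + G * Y" for t i
  proof -
    have "norm (grad1 K f t (x t) (\<nu> t) $ i) \<le> G"
      using Finite_Cartesian_Product.norm_nth_le norm_grad1[OF x_stacked] by (rule order_trans)
    moreover have "norm (jacobian_T (K i) (\<psi> i) (x t $ i) *v (y t $ i)) \<le> G * Y"
      using norm_matrix_vector_le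
      by (rule order_trans) (intro mult_mono norm_jacobian x_mem Y; use G_pos in simp)
    ultimately show ?thesis
      unfolding d_def by (rule norm_triangle_mono)
  qed
  then show ?thesis using G_pos Y(1) by (intro exI[of _ "G + G * Y"]) auto
qed

text \<open>A point of \<open>X i\<close> is its own projection, so a projected step is no longer
  than the step before projection.\<close>

lemma l1_x_step: "\<exists>D\<ge>0. \<forall>t. l1 (x (Suc t) - x t) \<le> D * \<alpha> t"
proof -
  obtain D where D: "0 \<le> D" "\<And>t i. norm (d t i) \<le> D"
    using d_bounded by blast
  have "norm ((x (Suc t) - x t) $ i) \<le> \<alpha> t * D" for t i
  proof -
    have "norm (x (Suc t) $ i - x t $ i) \<le> norm (\<alpha> t *\<^sub>R d t i)"
      using closest_point_lipschitz[of "X i" "x t $ i - \<alpha> t *\<^sub>R d t i" "x t $ i"]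
      by (simp add: X_sets compact_imp_closed closest_point_self x_mem x_Suc dist_norm)
    also have "\<dots> \<le> \<alpha> t * D"
      using D(2) alpha_pos[of t] by simp
    finally show ?thesis by simp
  qed
  then have "l1 (x (Suc t) - x t) \<le> real CARD('n) * D * \<alpha> t" for t
    unfolding l1_def
    using sum_bounded_above[of UNIV "\<lambda>i. norm ((x (Suc t) - x t) $ i)" "\<alpha> t * D"]
    by (simp add: ac_simps)
  then show ?thesis using D(1) by (intro exI[of _ "real CARD('n) * D"]) auto
qed

lemma l1_psi_step_le:
  "l1 (\<chi> i. \<psi> i (x (Suc t) $ i) - \<psi> i (x t $ i)) \<le> G * l1 (x (Suc t) - x t)"
  unfolding l1_def sum_distrib_left
  by (intro sum_mono)
    (use lipschitz_of_jacobian_bound[OF psi_diff X_sub X_sets(2) norm_jacobian x_mem x_mem] in simp)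

section \<open>Accumulated consensus errors\<close>

lemma sum_dev_nu: "\<exists>C\<ge>0. \<forall>T. (\<Sum>t<T. l1 (dev (\<nu> t))) \<le> C * (1 + (\<Sum>t<T. \<alpha> t))"
proof -
  let ?u = "\<lambda>t. \<chi> i. \<psi> i (x (Suc t) $ i) - \<psi> i (x t $ i)"
  obtain C where C: "0 \<le> C" "\<And>T. (\<Sum>t<T. l1 (dev (\<nu> t))) \<le> C * (1 + (\<Sum>t<T. l1 (?u t)))"
    using consensus_sum_bound[where A=A and E=E and z=\<nu>, OF A_ds a_pos A_diag A_edge conn Q_pos nu_Suc] by blast
  obtain D where D: "0 \<le> D" "\<And>t. l1 (x (Suc t) - x t) \<le> D * \<alpha> t"
    using l1_x_step by blast
  have "(\<Sum>t<T. l1 (dev (\<nu> t))) \<le> C * (1 + G * D) * (1 + (\<Sum>t<T. \<alpha> t))" for T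
  proof -
    have pos: "0 \<le> (\<Sum>t<T. \<alpha> t)" by (simp add: sum_nonneg alpha_pos less_imp_le)
    have "l1 (?u t) \<le> G * D * \<alpha> t" for t
      using order_trans[OF l1_psi_step_le mult_left_mono[OF D(2)[of t]]] G_pos
      by (simp add: mult.assoc)
    then have "(\<Sum>t<T. l1 (?u t)) \<le> G * D * (\<Sum>t<T. \<alpha> t)"
      unfolding sum_distrib_left by (rule sum_mono)
    \<comment> \<open>Slack is added so that, after adding 1, the bound factors as
      \<open>(1 + G * D) * (1 + (\<Sum>t<T. \<alpha> t))\<close>.\<close>
    also have "\<dots> \<le> G * D * (1 + (\<Sum>t<T. \<alpha> t)) + (\<Sum>t<T. \<alpha> t)"
      using pos D(1) G_pos by (simp add: algebra_simps)
    finally have "1 + (\<Sum>t<T. l1 (?u t)) \<le> (1 + G * D) * (1 + (\<Sum>t<T. \<alpha> t))"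
      by (simp add: algebra_simps)
    from mult_left_mono[OF this C(1)] show ?thesis
      using C(2)[of T] by (simp add: mult.assoc)
  qed
  then show ?thesis
    using C(1) D(1) G_pos by (intro exI[of _ "C * (1 + G * D)"]) auto
qed

lemma grad_change_bound:
  assumes "u \<in> stacked X"
  shows "l1 (grad2 f (Suc t) u w - grad2 f t u w) \<le> grad_change X f t"
  unfolding l1_def grad_change_def
proof (rule sum_mono)
  fix i
  let ?h = "\<lambda>(v, z). norm (grad_on UNIV (f (Suc t) i v) z - grad_on UNIV (f t i v) z)"
  have "norm (grad_on UNIV (f s i v) z) \<le> G" if "v \<in> X i" for s v z
  proof -
    \<comment> \<open>The gradient bound is for stacked points; putting \<open>v\<close> into
      position \<open>i\<close> of a feasible point localizes it to one agent. This bounds the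
      family, without which the supremum would give no upper bound.\<close>
    let ?u = "\<chi> j. if j = i then v else u $ j"
    have "?u \<in> stacked X" using assms that by (simp add: stacked_def)
    then have "norm (grad2 f s ?u (\<chi> j. z) $ i) \<le> G"
      using Finite_Cartesian_Product.norm_nth_le norm_grad2 order_trans by blast
    then show ?thesis by (simp add: grad2_def)
  qed
  then have "?h p \<le> G + G" if "p \<in> X i \<times> UNIV" for p
    using that by (cases p) (smt (verit) SigmaD1 norm_triangle_ineq4 prod.case)
  then have "bdd_above (?h ` (X i \<times> UNIV))"
    by (rule bdd_aboveI2)
  moreover have "(u $ i, w $ i) \<in> X i \<times> UNIV" using assms by (simp add: stacked_def)
  ultimately have "?h (u $ i, w $ i) \<le> (SUP p\<in>X i \<times> UNIV. ?h p)"
    by (rule cSUP_upper[rotated])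
  then show "norm ((grad2 f (Suc t) u w - grad2 f t u w) $ i) \<le>
      (SUP (v, z)\<in>X i \<times> UNIV. norm (grad_on UNIV (f (Suc t) i v) z - grad_on UNIV (f t i v) z))"
    by (simp add: grad2_def)
qed

lemma grad_change_nonneg: "0 \<le> grad_change X f t"
  using grad_change_bound[OF x_stacked] l1_nonneg order_trans by blast

text \<open>The mean part of \<open>\<nu> t\<close> is fixed by mixing, so mixing moves
  \<open>\<nu> t\<close> only through its deviation, by at most twice its size.\<close>

lemma l1_nu_step_le: "l1 (\<nu> (Suc t) - \<nu> t) \<le> 2 * l1 (dev (\<nu> t)) + G * l1 (x (Suc t) - x t)"
proof -
  let ?u = "\<chi> i. \<psi> i (x (Suc t) $ i) - \<psi> i (x t $ i)"
  have "\<nu> (Suc t) - \<nu> t = (mix (A t) (dev (\<nu> t)) - dev (\<nu> t)) + ?u"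
    by (simp add: nu_Suc flip: dev_mix[OF A_ds]) (simp add: dev_def vec_eq_iff mean_mix[OF A_ds])
  then show ?thesis
    using l1_add[of "mix (A t) (dev (\<nu> t)) - dev (\<nu> t)" ?u] l1_psi_step_le[of t]
      l1_diff[of "mix (A t) (dev (\<nu> t))" "dev (\<nu> t)"] l1_mix_le_ds[OF A_ds, of t "dev (\<nu> t)"]
    by simp
qed

lemma sum_dev_y:
  "\<exists>C\<ge>0. \<forall>T. (\<Sum>t<T. l1 (dev (y t))) \<le> C * (1 + (\<Sum>t<T. \<alpha> t) + (\<Sum>t<T. grad_change X f t))"
proof -
  obtain C where C: "0 \<le> C"
    "\<And>T. (\<Sum>t<T. l1 (dev (y t))) \<le> C * (1 + (\<Sum>t<T. l1 (g (Suc t) - g t)))"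
    using consensus_sum_bound[where A=A and E=E and z=y, OF A_ds a_pos A_diag A_edge conn Q_pos y_Suc] by blast
  obtain C' where C': "0 \<le> C'" "\<And>T. (\<Sum>t<T. l1 (dev (\<nu> t))) \<le> C' * (1 + (\<Sum>t<T. \<alpha> t))"
    using sum_dev_nu by blast
  obtain D where D: "0 \<le> D" "\<And>t. l1 (x (Suc t) - x t) \<le> D * \<alpha> t"
    using l1_x_step by blast
  have step: "l1 (g (Suc t) - g t) \<le>
      real CARD('n) * L * (1 + G) * D * \<alpha> t + 2 * real CARD('n) * L * l1 (dev (\<nu> t)) + grad_change X f t" for t
  proof -
    \<comment> \<open>The new loss at the old arguments separates the change of arguments,
      controlled by the Lipschitz bound, from the change of the loss over time.\<close>
    let ?g' = "grad2 f (Suc t) (x t) (\<nu> t)"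
    have "l1 (g (Suc t) - ?g') \<le> real CARD('n) * norm (g (Suc t) - ?g')" by (rule l1_le_norm)
    also have "\<dots> \<le> real CARD('n) * (L * (norm (x (Suc t) - x t) + norm (\<nu> (Suc t) - \<nu> t)))"
      unfolding g_def by (intro mult_left_mono grad2_lipschitz x_stacked) simp
    also have "\<dots> \<le> real CARD('n) * (L * (D * \<alpha> t + (2 * l1 (dev (\<nu> t)) + G * (D * \<alpha> t))))"
    proof (intro mult_left_mono add_mono L_nonneg)
      show "norm (x (Suc t) - x t) \<le> D * \<alpha> t"
        using norm_le_l1 D(2) by (rule order_trans)
      have "G * l1 (x (Suc t) - x t) \<le> G * (D * \<alpha> t)"
        using D(2) G_pos by (intro mult_left_mono) auto
      then show "norm (\<nu> (Suc t) - \<nu> t) \<le> 2 * l1 (dev (\<nu> t)) + G * (D * \<alpha> t)"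
        using norm_le_l1[of "\<nu> (Suc t) - \<nu> t"] l1_nu_step_le[of t] by simp
    qed simp
    also have "\<dots> = real CARD('n) * L * (1 + G) * D * \<alpha> t + 2 * real CARD('n) * L * l1 (dev (\<nu> t))"
      by (simp add: algebra_simps)
    finally show ?thesis
      using l1_add[of "g (Suc t) - ?g'" "?g' - g t"]
        grad_change_bound[OF x_stacked[of t], of t "\<nu> t"]
      by (simp add: g_def)
  qed
  \<comment> \<open>The summand \<open>1\<close> covers the coefficient of the gradient change as
    well as the additive 1 in the bound for \<open>y\<close>.\<close>
  define H where "H = 1 + real CARD('n) * L * (1 + G) * D + 2 * real CARD('n) * L * C'"
  have H: "1 \<le> H" using L_nonneg G_pos D(1) C'(1) by (simp add: H_def)
  have "(\<Sum>t<T. l1 (dev (y t))) \<le> C * H * (1 + (\<Sum>t<T. \<alpha> t) + (\<Sum>t<T. grad_change X f t))" for T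
  proof -
    let ?a = "\<Sum>t<T. \<alpha> t" and ?V = "\<Sum>t<T. grad_change X f t"
    have pos: "0 \<le> ?a" "0 \<le> ?V"
      by (auto simp: sum_nonneg grad_change_nonneg alpha_pos less_imp_le)
    have "(\<Sum>t<T. l1 (g (Suc t) - g t)) \<le>
        (\<Sum>t<T. real CARD('n) * L * (1 + G) * D * \<alpha> t + 2 * real CARD('n) * L * l1 (dev (\<nu> t)) + grad_change X f t)"
      by (intro sum_mono step)
    also have "\<dots> = real CARD('n) * L * (1 + G) * D * ?a + 2 * real CARD('n) * L * (\<Sum>t<T. l1 (dev (\<nu> t))) + ?V"
      by (simp only: sum.distrib sum_distrib_left)
    also have "\<dots> \<le> real CARD('n) * L * (1 + G) * D * (1 + ?a) + 2 * real CARD('n) * L * (C' * (1 + ?a)) + ?V"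
      using L_nonneg G_pos D(1) C' by (intro add_mono mult_left_mono) auto
    also have "\<dots> = (H - 1) * (1 + ?a) + ?V"
      by (simp add: H_def algebra_simps)
    also have "\<dots> \<le> H * (1 + ?a + ?V) - 1"
    proof -
      have "?V \<le> H * ?V" using H pos mult_right_mono[of 1 H ?V] by simp
      then show ?thesis using pos by (simp add: algebra_simps)
    qed
    finally have "1 + (\<Sum>t<T. l1 (g (Suc t) - g t)) \<le> H * (1 + ?a + ?V)" by simp
    from mult_left_mono[OF this C(1)] show ?thesis
      using C(2)[of T] by (simp add: mult.assoc)
  qed
  then show ?thesis
    using C(1) H by (intro exI[of _ "C * H"]) auto
qed

section \<open>Regret of one round and its summation\<close>

lemma instant_regret_le:
  assumes u: "u \<in> stacked X"
  shows "total_loss f \<psi> t (x t) - total_loss f \<psi> t u \<le>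
    (\<Sum>i\<in>UNIV. d t i \<bullet> (x t $ i - u $ i))
      + 2 * B * (real CARD('n) * L * (1 + G) * l1 (dev (\<nu> t)) + G * l1 (dev (y t)))"
proof -
  \<comment> \<open>The exact gradient, with every agent given the true aggregate, is compared with
    the direction used; by \<open>mean_nu\<close> the gap between the arguments is the deviation of
    \<open>\<nu>\<close>.\<close>
  define w where "w = (\<chi> i::'n. aggregate \<psi> (x t))"
  let ?J = "\<lambda>i. jacobian_T (K i) (\<psi> i) (x t $ i)"
  let ?m = "mean (grad2 f t (x t) w)"
  define F where "F i = grad1 K f t (x t) w $ i + ?J i *v ?m" for i
  have w: "\<nu> t - w = dev (\<nu> t)"
    by (simp add: w_def dev_def vec_eq_iff mean_nu)
  have Le: "real CARD('n) * (L * (norm (x t - x t) + norm (w - \<nu> t))) \<le> real CARD('n) * L * l1 (dev (\<nu> t))"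
    using norm_le_l1[of "dev (\<nu> t)"] L_nonneg
    by (simp add: norm_minus_commute[of w] w mult.assoc mult_left_mono)
  have g1: "l1 (grad1 K f t (x t) w - grad1 K f t (x t) (\<nu> t)) \<le> real CARD('n) * L * l1 (dev (\<nu> t))"
    by (rule order_trans[OF l1_le_norm order_trans[OF mult_left_mono[OF
        grad1_lipschitz[OF x_stacked x_stacked]] Le]]) simp
  have g2: "l1 (grad2 f t (x t) w - g t) \<le> real CARD('n) * L * l1 (dev (\<nu> t))"
    unfolding g_def
    by (rule order_trans[OF l1_le_norm order_trans[OF mult_left_mono[OF
        grad2_lipschitz[OF x_stacked x_stacked]] Le]]) simp
  have diff: "norm (F i - d t i) \<le> norm ((grad1 K f t (x t) w - grad1 K f t (x t) (\<nu> t)) $ i)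
      + G * (norm (mean (grad2 f t (x t) w - g t)) + norm (dev (y t) $ i))" for i
  proof -
    \<comment> \<open>Since the mean of \<open>y\<close> is the mean of \<open>g\<close>, the gap
      splits into the averaged gradient error and the disagreement of agent
      \<open>i\<close>.\<close>
    have "?m - y t $ i = mean (grad2 f t (x t) w - g t) - dev (y t) $ i"
      by (simp add: dev_def mean_y) (simp add: mean_def sum_subtractf scaleR_diff_right)
    then have "norm (?m - y t $ i) \<le> norm (mean (grad2 f t (x t) w - g t)) + norm (dev (y t) $ i)"
      by (simp add: norm_triangle_ineq4)
    then have "norm (?J i *v (?m - y t $ i)) \<le>
        G * (norm (mean (grad2 f t (x t) w - g t)) + norm (dev (y t) $ i))"
      using G_pos by (intro order_trans[OF norm_matrix_vector_le] mult_mono norm_jacobian x_mem) auto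
    moreover have "F i - d t i =
        (grad1 K f t (x t) w - grad1 K f t (x t) (\<nu> t)) $ i + ?J i *v (?m - y t $ i)"
      by (simp add: F_def d_def matrix_vector_mult_diff_distrib)
    ultimately show ?thesis
      using norm_triangle_mono order_refl by metis
  qed
  have "(\<Sum>i\<in>UNIV. norm (F i - d t i)) \<le>
      (\<Sum>i\<in>UNIV. norm ((grad1 K f t (x t) w - grad1 K f t (x t) (\<nu> t)) $ i)
        + G * (norm (mean (grad2 f t (x t) w - g t)) + norm (dev (y t) $ i)))"
    by (intro sum_mono diff)
  also have "\<dots> = l1 (grad1 K f t (x t) w - grad1 K f t (x t) (\<nu> t))
      + G * (real CARD('n) * norm (mean (grad2 f t (x t) w - g t)) + l1 (dev (y t)))"
    by (simp add: l1_def sum.distrib flip: sum_distrib_left)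
  also have "\<dots> \<le> real CARD('n) * L * l1 (dev (\<nu> t)) + G * (real CARD('n) * L * l1 (dev (\<nu> t)) + l1 (dev (y t)))"
    using g1 order_trans[OF norm_mean_le g2] G_pos
    by (intro add_mono[OF _ mult_left_mono[OF add_right_mono]]) auto
  also have "\<dots> = real CARD('n) * L * (1 + G) * l1 (dev (\<nu> t)) + G * l1 (dev (y t))"
    by (simp add: algebra_simps)
  finally have err: "(\<Sum>i\<in>UNIV. norm (F i - d t i)) \<le>
      real CARD('n) * L * (1 + G) * l1 (dev (\<nu> t)) + G * l1 (dev (y t))" .
  \<comment> \<open>Errors in the direction cost at most the diameter bound \<open>2 * B\<close> of
    each decision set.\<close>
  have "(F i - d t i) \<bullet> (x t $ i - u $ i) \<le> 2 * B * norm (F i - d t i)" for i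
  proof -
    have "norm (x t $ i - u $ i) \<le> 2 * B"
      using u x_mem by (intro norm_diff_le) (auto simp: stacked_def)
    then show ?thesis
      using norm_cauchy_schwarz[of "F i - d t i" "x t $ i - u $ i"]
        mult_left_mono[of "norm (x t $ i - u $ i)" "2 * B" "norm (F i - d t i)"]
      by (simp add: mult.commute)
  qed
  then have "(\<Sum>i\<in>UNIV. F i \<bullet> (x t $ i - u $ i)) - (\<Sum>i\<in>UNIV. d t i \<bullet> (x t $ i - u $ i)) \<le>
      2 * B * (\<Sum>i\<in>UNIV. norm (F i - d t i))"
    unfolding sum_distrib_left sum_subtractf[symmetric] inner_diff_left[symmetric]
    by (rule sum_mono)
  moreover have "total_loss f \<psi> t (x t) - total_loss f \<psi> t u \<le> (\<Sum>i\<in>UNIV. F i \<bullet> (x t $ i - u $ i))"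
    unfolding F_def w_def using u
    by (intro total_loss_above_tangent psi_diff f_diff loss_convex)
      (auto simp: stacked_def x_mem intro: subsetD[OF X_sub])
  moreover have "2 * B * (\<Sum>i\<in>UNIV. norm (F i - d t i)) \<le>
      2 * B * (real CARD('n) * L * (1 + G) * l1 (dev (\<nu> t)) + G * l1 (dev (y t)))"
    using err B_pos by (intro mult_left_mono) auto
  ultimately show ?thesis by linarith
qed

lemma descent:
  assumes u: "u \<in> stacked X" and D: "\<And>i. norm (d t i) \<le> D"
  shows "(\<Sum>i\<in>UNIV. d t i \<bullet> (x t $ i - u $ i)) \<le>
    ((norm (x t - u))\<^sup>2 - (norm (x (Suc t) - u))\<^sup>2) / (2 * \<alpha> t) + real CARD('n) * D\<^sup>2 / 2 * \<alpha> t"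
proof -
  have "d t i \<bullet> (x t $ i - u $ i) \<le>
      ((norm (x t $ i - u $ i))\<^sup>2 - (norm (x (Suc t) $ i - u $ i))\<^sup>2) / (2 * \<alpha> t) + \<alpha> t / 2 * D\<^sup>2" for i
  proof -
    have "\<alpha> t / 2 * (norm (d t i))\<^sup>2 \<le> \<alpha> t / 2 * D\<^sup>2"
      using D alpha_pos[of t] by (intro mult_left_mono power_mono) auto
    moreover have "d t i \<bullet> (x t $ i - u $ i) \<le>
        ((norm (x t $ i - u $ i))\<^sup>2 - (norm (x (Suc t) $ i - u $ i))\<^sup>2) / (2 * \<alpha> t)
          + \<alpha> t / 2 * (norm (d t i))\<^sup>2"
      unfolding x_Suc using u alpha_pos
      by (intro projected_step_inner_le) (auto simp: stacked_def X_sets compact_imp_closed)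
    ultimately show ?thesis by linarith
  qed
  then have "(\<Sum>i\<in>UNIV. d t i \<bullet> (x t $ i - u $ i)) \<le> (\<Sum>i\<in>UNIV.
      ((norm (x t $ i - u $ i))\<^sup>2 - (norm (x (Suc t) $ i - u $ i))\<^sup>2) / (2 * \<alpha> t) + \<alpha> t / 2 * D\<^sup>2)"
    by (rule sum_mono)
  then show ?thesis
    by (simp add: norm_vec_power2 sum.distrib sum_subtractf mult.commute mult.left_commute
        flip: sum_divide_distrib)
qed

text \<open>In the difference of squares, the difference of the norms is at most the drift by the
  reverse triangle inequality, and their sum is at most twice a diameter bound.\<close>

lemma comparator_drift:
  "(norm (x (Suc t) - xopt (Suc t)))\<^sup>2 - (norm (x (Suc t) - xopt t))\<^sup>2 \<le>
    4 * real CARD('n) * B * norm (xopt (Suc t) - xopt t)"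
proof -
  define p q where "p = norm (x (Suc t) - xopt (Suc t))" and "q = norm (x (Suc t) - xopt t)"
  have pq: "0 \<le> p" "0 \<le> q" "p \<le> real CARD('n) * (2 * B)" "q \<le> real CARD('n) * (2 * B)"
    by (auto simp: p_def q_def intro!: norm_stacked_diff_le x_stacked xopt_stacked)
  have "p - q \<le> norm (xopt (Suc t) - xopt t)"
    unfolding p_def q_def using norm_triangle_ineq2[of "x (Suc t) - xopt (Suc t)" "x (Suc t) - xopt t"]
    by (simp add: norm_minus_commute)
  then have "(p - q) * (p + q) \<le> norm (xopt (Suc t) - xopt t) * (p + q)"
    using pq by (intro mult_right_mono) auto
  also have "\<dots> \<le> norm (xopt (Suc t) - xopt t) * (4 * real CARD('n) * B)"
    using pq by (intro mult_left_mono) auto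
  finally have "(p - q) * (p + q) \<le> norm (xopt (Suc t) - xopt t) * (4 * real CARD('n) * B)" .
  then show ?thesis
    by (simp add: p_def q_def power2_eq_square algebra_simps)
qed

lemma sum_alpha_le: "(\<Sum>t<Suc T. \<alpha> t) \<le> 1 + 2 * sqrt (real T)"
proof -
  have "(\<Sum>t<Suc T. \<alpha> t) = \<alpha> 0 + (\<Sum>t=1..T. \<alpha> t)"
    by (simp add: lessThan_Suc_atMost atMost_atLeast0 sum.atLeast_Suc_atMost del: sum.lessThan_Suc)
  also have "(\<Sum>t=1..T. \<alpha> t) = (\<Sum>t=1..T. 1 / sqrt (real t))"
    by (intro sum.cong) (auto simp: alpha)
  finally show ?thesis using sum_inverse_sqrt_le[of T] alpha(1) by simp
qed

lemma dynamic_regret_nonneg: "0 \<le> dynamic_regret f \<psi> x xopt T"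
  unfolding dynamic_regret_def by (simp add: sum_mono xopt_le x_stacked)

lemma dynamic_regret_le:
  "\<exists>C\<ge>0. \<forall>T\<ge>1. dynamic_regret f \<psi> x xopt T \<le>
    C * (sqrt (real T) + path_variation \<alpha> xopt T + grad_variation X f T)"
proof -
  obtain C where C: "0 \<le> C" "\<And>T. (\<Sum>t<T. l1 (dev (\<nu> t))) \<le> C * (1 + (\<Sum>t<T. \<alpha> t))"
    using sum_dev_nu by blast
  obtain C' where C': "0 \<le> C'"
    "\<And>T. (\<Sum>t<T. l1 (dev (y t))) \<le> C' * (1 + (\<Sum>t<T. \<alpha> t) + (\<Sum>t<T. grad_change X f t))"
    using sum_dev_y by blast
  obtain D where D: "0 \<le> D" "\<And>t i. norm (d t i) \<le> D"
    using d_bounded by blast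
  define p where "p t = (norm (x t - xopt t))\<^sup>2" for t
  \<comment> \<open>The tracking bound starts at time 0, while \<open>grad_variation\<close> starts
    at 1; the missing change at time 0 becomes part of the constant.\<close>
  define V where "V = grad_change X f 0"
  have V: "0 \<le> V" by (simp add: V_def grad_change_nonneg)
  define P where "P = (real CARD('n) * (2 * B))\<^sup>2"
  have p: "0 \<le> p t" "p t \<le> P" for t
    unfolding p_def P_def
    by (auto intro!: power_mono norm_stacked_diff_le x_stacked xopt_stacked)
  define c1 c2 where "c1 = 2 * B * (real CARD('n) * L * (1 + G))" and "c2 = 2 * B * G"
  have c: "0 \<le> c1" "0 \<le> c2" using B_pos G_pos L_nonneg by (auto simp: c1_def c2_def)
  \<comment> \<open>Tangent bound and projected step use the comparator \<open>xopt t\<close>; the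
    drift term replaces it by \<open>xopt (Suc t)\<close> so that the squared distances
    \<open>p\<close> can telescope.\<close>
  have one: "total_loss f \<psi> t (x t) - total_loss f \<psi> t (xopt t) \<le>
      1 / (2 * \<alpha> t) * (p t - p (Suc t))
      + 2 * real CARD('n) * B * (1 / \<alpha> t * norm (xopt (Suc t) - xopt t))
      + real CARD('n) * D\<^sup>2 / 2 * \<alpha> t + c1 * l1 (dev (\<nu> t)) + c2 * l1 (dev (y t))" for t
  proof -
    have "((norm (x t - xopt t))\<^sup>2 - (norm (x (Suc t) - xopt t))\<^sup>2) / (2 * \<alpha> t) \<le>
        (p t - p (Suc t) + 4 * real CARD('n) * B * norm (xopt (Suc t) - xopt t)) / (2 * \<alpha> t)"
      using comparator_drift[of t] alpha_pos[of t] by (intro divide_right_mono) (auto simp: p_def)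
    also have "\<dots> = 1 / (2 * \<alpha> t) * (p t - p (Suc t))
      + 2 * real CARD('n) * B * (1 / \<alpha> t * norm (xopt (Suc t) - xopt t))"
      using alpha_pos[of t] by (simp add: field_simps)
    finally show ?thesis
      using instant_regret_le[OF xopt_stacked, of t t] descent[OF xopt_stacked D(2), of t t]
      by (simp add: c1_def c2_def algebra_simps)
  qed
  define H where "H = P / 2 + 2 * real CARD('n) * B + 2 * real CARD('n) * D\<^sup>2 + 4 * c1 * C + c2 * C' * (4 + V)"
  have terms: "0 \<le> P / 2" "0 \<le> 2 * real CARD('n) * B" "0 \<le> real CARD('n) * D\<^sup>2" "0 \<le> c1 * C" "0 \<le> c2 * C'" "0 \<le> c2 * C' * V"
    using B_pos V C C' c by (auto simp: P_def)
  have "dynamic_regret f \<psi> x xopt T \<le>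
      H * (sqrt (real T) + path_variation \<alpha> xopt T + grad_variation X f T)" if T: "T \<ge> 1" for T
  proof -
    define r where "r = sqrt (real T)"
    let ?Vp = "path_variation \<alpha> xopt T" and ?Vg = "grad_variation X f T"
    have r: "1 \<le> r" using T by (simp add: r_def)
    have pos: "0 \<le> ?Vp" "0 \<le> ?Vg"
      using alpha_pos grad_change_nonneg
      by (auto simp: path_variation_def grad_variation_def less_imp_le intro!: sum_nonneg)
    have a: "(\<Sum>t<Suc T. \<alpha> t) \<le> 1 + 2 * r" using sum_alpha_le by (simp add: r_def)
    have "dynamic_regret f \<psi> x xopt T =
        (\<Sum>t=1..T. total_loss f \<psi> t (x t) - total_loss f \<psi> t (xopt t))"
      by (simp add: dynamic_regret_def sum_subtractf)
    also have "\<dots> \<le> (\<Sum>t=1..T. 1 / (2 * \<alpha> t) * (p t - p (Suc t))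
      + 2 * real CARD('n) * B * (1 / \<alpha> t * norm (xopt (Suc t) - xopt t))
      + real CARD('n) * D\<^sup>2 / 2 * \<alpha> t + c1 * l1 (dev (\<nu> t)) + c2 * l1 (dev (y t)))"
      by (intro sum_mono one)
    also have "\<dots> = (\<Sum>t=1..T. 1 / (2 * \<alpha> t) * (p t - p (Suc t))) + 2 * real CARD('n) * B * ?Vp
      + real CARD('n) * D\<^sup>2 / 2 * (\<Sum>t=1..T. \<alpha> t) + c1 * (\<Sum>t=1..T. l1 (dev (\<nu> t)))
      + c2 * (\<Sum>t=1..T. l1 (dev (y t)))"
      by (simp only: sum.distrib sum_distrib_left path_variation_def)
    also have "\<dots> \<le> P / 2 * r + 2 * real CARD('n) * B * ?Vp + real CARD('n) * D\<^sup>2 / 2 * (4 * r)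
      + c1 * (C * (4 * r)) + c2 * (C' * (4 * r + V + ?Vg))"
    proof (intro add_mono mult_left_mono c)
      \<comment> \<open>The weights \<open>sqrt (real t) / 2\<close> increase with time, so
        summation by parts leaves only the last weight.\<close>
      have "(\<Sum>t=1..T. 1 / (2 * \<alpha> t) * (p t - p (Suc t))) =
          (\<Sum>t=1..T. sqrt (real t) / 2 * (p t - p (Suc t)))"
        by (intro sum.cong) (auto simp: alpha)
      also have "\<dots> \<le> r / 2 * P"
        unfolding r_def by (rule weighted_telescope_le[OF p]) auto
      finally show "(\<Sum>t=1..T. 1 / (2 * \<alpha> t) * (p t - p (Suc t))) \<le> P / 2 * r"
        by (simp add: mult.commute)
      show "(\<Sum>t=1..T. \<alpha> t) \<le> 4 * r"
        using sum_le_lessThan_Suc[of \<alpha> T] alpha_pos a r by (auto simp: less_imp_le)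
      have "(\<Sum>t=1..T. l1 (dev (\<nu> t))) \<le> C * (1 + (\<Sum>t<Suc T. \<alpha> t))"
        using sum_le_lessThan_Suc[of "\<lambda>t. l1 (dev (\<nu> t))" T] C(2)[of "Suc T"]
        by (auto simp: l1_nonneg)
      also have "\<dots> \<le> C * (4 * r)"
        using C(1) a r by (intro mult_left_mono) auto
      finally show "(\<Sum>t=1..T. l1 (dev (\<nu> t))) \<le> C * (4 * r)" .
      have "(\<Sum>t<Suc T. grad_change X f t) = V + ?Vg"
        by (simp add: lessThan_Suc_atMost atMost_atLeast0 sum.atLeast_Suc_atMost V_def
            grad_variation_def del: sum.lessThan_Suc)
      then have "(\<Sum>t=1..T. l1 (dev (y t))) \<le> C' * (1 + (\<Sum>t<Suc T. \<alpha> t) + (V + ?Vg))"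
        using sum_le_lessThan_Suc[of "\<lambda>t. l1 (dev (y t))" T] C'(2)[of "Suc T"]
        by (auto simp: l1_nonneg)
      also have "\<dots> \<le> C' * (4 * r + V + ?Vg)"
        using C'(1) a r by (intro mult_left_mono) auto
      finally show "(\<Sum>t=1..T. l1 (dev (y t))) \<le> C' * (4 * r + V + ?Vg)" .
    qed (use B_pos in auto)
    also have "\<dots> \<le> H * (r + ?Vp + ?Vg)"
    proof -
      \<comment> \<open>Because \<open>r\<close> is at least 1, the constant \<open>V\<close> is at
        most \<open>V * r\<close> and joins the square root term.\<close>
      have "(4 + V) * (r + ?Vg) = 4 * r + V * r + 4 * ?Vg + V * ?Vg"
        by (simp add: algebra_simps)
      then have "4 * r + V + ?Vg \<le> (4 + V) * (r + ?Vg)"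
        using mult_left_mono[OF r V] mult_nonneg_nonneg[OF V pos(2)] pos(2) by linarith
      then have "c2 * (C' * (4 * r + V + ?Vg)) \<le> c2 * (C' * ((4 + V) * (r + ?Vg)))"
        using c C' by (intro mult_left_mono)
      then have "P / 2 * r + 2 * real CARD('n) * B * ?Vp + real CARD('n) * D\<^sup>2 / 2 * (4 * r) + c1 * (C * (4 * r))
          + c2 * (C' * (4 * r + V + ?Vg)) \<le>
        P / 2 * r + 2 * real CARD('n) * B * ?Vp + 2 * real CARD('n) * D\<^sup>2 * r + 4 * c1 * C * r + c2 * C' * (4 + V) * (r + ?Vg)"
        by (simp add: mult.assoc)
      also have "\<dots> \<le> P / 2 * (r + ?Vp + ?Vg) + 2 * real CARD('n) * B * (r + ?Vp + ?Vg)
          + 2 * real CARD('n) * D\<^sup>2 * (r + ?Vp + ?Vg) + 4 * c1 * C * (r + ?Vp + ?Vg)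
          + c2 * C' * (4 + V) * (r + ?Vp + ?Vg)"
        using r pos terms c C C' V B_pos by (intro add_mono mult_left_mono) auto
      also have "\<dots> = H * (r + ?Vp + ?Vg)"
        by (simp add: H_def algebra_simps)
      finally show ?thesis .
    qed
    finally show ?thesis by (simp add: r_def)
  qed
  moreover have "0 \<le> H"
    unfolding H_def using terms c C C' V B_pos by (intro add_nonneg_nonneg) auto
  ultimately show ?thesis by blast
qed

end

section \<open>Splitting the regret into the three terms\<close>

theorem theorem1:
  fixes K :: "'n::finite \<Rightarrow> 'm::finite set"
    and X :: "'n \<Rightarrow> (real ^ 'm) set"
    and \<psi> :: "'n \<Rightarrow> real ^ 'm \<Rightarrow> real ^ 'd::finite"
    and f :: "nat \<Rightarrow> 'n \<Rightarrow> real ^ 'm \<Rightarrow> real ^ 'd \<Rightarrow> real"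
    and E :: "nat \<Rightarrow> ('n \<times> 'n) set"
    and A :: "nat \<Rightarrow> real ^ 'n ^ 'n"
    and \<alpha> :: "nat \<Rightarrow> real"
    and x xopt :: "nat \<Rightarrow> real ^ 'm ^ 'n"
    and \<nu> y :: "nat \<Rightarrow> real ^ 'd ^ 'n"
    and B L\<^sub>1 L\<^sub>2 G a :: real and Q :: nat
  assumes X_sub: "\<And>i. X i \<subseteq> coord_space (K i)"
    and psi_diff: "\<And>i. \<psi> i differentiable_on coord_space (K i)"
    and f_diff: "\<And>t i. (\<lambda>(v, z). f t i v z) differentiable_on coord_space (K i) \<times> UNIV"
    and edges: "\<And>t i j. i \<noteq> j \<Longrightarrow> if (j, i) \<in> E t then A t $ i $ j > 0 else A t $ i $ j = 0"
    and A_nonneg: "\<And>t i j. A t $ i $ j \<ge> 0"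
    and X_sets: "\<And>i. X i \<noteq> {} \<and> convex (X i) \<and> compact (X i)"
    and B: "B > 0" "\<And>i v. v \<in> X i \<Longrightarrow> norm v \<le> B"
    and loss_convex: "\<And>t. convex_on (stacked (\<lambda>i. coord_space (K i))) (total_loss f \<psi> t)"
    and L1_1: "\<And>t u u' w w'. u \<in> stacked X \<Longrightarrow> u' \<in> stacked X \<Longrightarrow>
          norm (grad1 K f t u w - grad1 K f t u' w') \<le> L\<^sub>1 * (norm (u - u') + norm (w - w'))"
    and L1_2: "\<And>t u u' w w'. u \<in> stacked X \<Longrightarrow> u' \<in> stacked X \<Longrightarrow>
          norm (grad2 f t u w - grad2 f t u' w') \<le> L\<^sub>1 * (norm (u - u') + norm (w - w'))"
    and G: "G > 0"
          "\<And>t u w. u \<in> stacked X \<Longrightarrow> norm (grad1 K f t u w) \<le> G"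
          "\<And>t u w. u \<in> stacked X \<Longrightarrow> norm (grad2 f t u w) \<le> G"
          "\<And>i v. v \<in> X i \<Longrightarrow> mat_norm (jacobian_T (K i) (\<psi> i) v) \<le> G"
    and L2: "\<And>i v v'. v \<in> X i \<Longrightarrow> v' \<in> X i \<Longrightarrow>
          mat_norm (jacobian_T (K i) (\<psi> i) v - jacobian_T (K i) (\<psi> i) v') \<le> L\<^sub>2 * norm (v - v')"
    and Q: "Q > 0" "\<And>k. strongly_connected (digraph_of (\<Union>l<Q. E (k + l)))"
    and A_ds: "\<And>t. doubly_stochastic (A t)"
    and a: "0 < a" "a < 1"
          "\<And>t i j. A t $ i $ j > 0 \<Longrightarrow> A t $ i $ j \<ge> a" "\<And>t i. A t $ i $ i \<ge> a"
    and alpha: "\<alpha> 0 = 1" "\<And>t. t \<ge> 1 \<Longrightarrow> \<alpha> t = 1 / sqrt (real t)"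
    and run: "odgt_run K X \<psi> f A \<alpha> x \<nu> y"
    and xopt: "\<And>t. is_arg_min (total_loss f \<psi> t) (\<lambda>u. u \<in> stacked X) (xopt t)"
  shows "\<exists>r\<^sub>1 r\<^sub>2 r\<^sub>3 :: nat \<Rightarrow> real.
           r\<^sub>1 \<in> O[horizon](\<lambda>T. sqrt (real T)) \<and>
           r\<^sub>2 \<in> O[horizon](\<lambda>T. path_variation \<alpha> xopt T) \<and>
           r\<^sub>3 \<in> O[horizon](\<lambda>T. max (grad_variation X f T) (grad_variation_weighted \<alpha> X f T)) \<and>
           (\<forall>T\<ge>1. dynamic_regret f \<psi> x xopt T = r\<^sub>1 T + r\<^sub>2 T + r\<^sub>3 T)"
proof -
  \<comment> \<open>\<open>edges\<close> speaks of distinct agents only; a self-loop is covered by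
    the bound on the diagonal.\<close>
  have edge: "a \<le> A t $ i $ j" if "(j, i) \<in> E t" for t i j
    using edges[of i j t] a(3)[of t i j] a(4)[of t i] that by (cases "i = j") auto
  \<comment> \<open>The given Lipschitz constant has no prescribed sign, so its nonnegative part is
    taken.\<close>
  have lip: "L\<^sub>1 * (norm p + norm q) \<le> max L\<^sub>1 0 * (norm p + norm q)"
    for p :: "real ^ 'm ^ 'n" and q :: "real ^ 'd ^ 'n"
    by (intro mult_right_mono) auto
  interpret odgt K X \<psi> f E A \<alpha> x xopt \<nu> y B "max L\<^sub>1 0" G a Q
    using X_sub psi_diff f_diff X_sets B loss_convex L1_1 L1_2 G Q A_ds a(1,4) edge alpha run xopt
    by unfold_locales (auto intro: order_trans[OF _ lip])
  obtain C where C: "0 \<le> C" and R_le: "\<And>T. T \<ge> 1 \<Longrightarrow> dynamic_regret f \<psi> x xopt T \<le>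
      C * (sqrt (real T) + path_variation \<alpha> xopt T + grad_variation X f T)"
    using dynamic_regret_le by blast
  let ?R = "dynamic_regret f \<psi> x xopt"
  define s p v where "s T = sqrt (real T)" and "p T = path_variation \<alpha> xopt T"
    and "v T = max (grad_variation X f T) (grad_variation_weighted \<alpha> X f T)" for T
  have pos: "0 < s T" "0 \<le> p T" "0 \<le> v T" if "T \<ge> 1" for T
    using that alpha_pos grad_change_nonneg
    by (auto simp: s_def p_def v_def path_variation_def grad_variation_def le_max_iff_disj less_imp_le
        intro!: sum_nonneg disjI1)
  \<comment> \<open>The regret is divided in proportion to the three bounds. An estimate over
    \<open>horizon\<close> must hold at every \<open>T \<ge> 1\<close>, so a term has to vanish
    wherever its bound does, as a multiple of that bound will. The denominator is positive thanks to
    the square root.\<close>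
  define q where "q T = ?R T / (s T + p T + v T)" for T
  have q: "0 \<le> q T" "q T \<le> C" "?R T = q T * s T + q T * p T + q T * v T" if T: "T \<ge> 1" for T
  proof -
    have S: "0 < s T + p T + v T" using pos[OF T] by linarith
    \<comment> \<open>\<open>v T\<close> is a maximum, hence at least the unweighted variation in
      the bound.\<close>
    have "?R T \<le> C * (s T + p T + v T)"
      using R_le[OF T] C unfolding s_def p_def v_def
      by (elim order_trans) (intro mult_left_mono, auto)
    then show "q T \<le> C" using S by (simp add: q_def pos_divide_le_eq)
    show "0 \<le> q T" using S dynamic_regret_nonneg by (simp add: q_def)
    have "q T * (s T + p T + v T) = ?R T" using S by (simp add: q_def)
    then show "?R T = q T * s T + q T * p T + q T * v T" by (simp add: algebra_simps)
  qed
  have O: "(\<lambda>T. q T * h T) \<in> O[horizon](h)" if "\<And>T. T \<ge> 1 \<Longrightarrow> 0 \<le> h T" for h :: "nat \<Rightarrow> real"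
    by (rule bigoI[of _ C]) (auto simp: eventually_principal abs_mult q that intro!: mult_right_mono)
  show ?thesis
    using O[of s] O[of p] O[of v] pos q(3) unfolding s_def p_def v_def
    by (intro exI[of _ "\<lambda>T. q T * sqrt (real T)"] exI[of _ "\<lambda>T. q T * path_variation \<alpha> xopt T"]
        exI[of _ "\<lambda>T. q T * max (grad_variation X f T) (grad_variation_weighted \<alpha> X f T)"])
      (auto simp: less_imp_le)
qed

end
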